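(* For $\tau$ in the upper half-plane and complex $x,y$ with $\theta_1(x|\tau)\theta_1(y|\tau)\ne0$, \begin{align*} &\left(\theta_1^5\!\left(x+\tfrac{\pi}{5}\Big|\tau\right)-\theta_1^5\!\left(x-\tfrac{\pi}{5}\Big|\tau\right)\right) \left(\theta_1^5\!\left(y+\tfrac{2\pi}{5}\Big|\tau\right)-\theta_1^5\!\left(y-\tfrac{2\pi}{5}\Big|\tau\right)\right)\\ &-\left(\theta_1^5\!\left(y+\tfrac{\pi}{5}\Big|\tau\right)-\theta_1^5\!\left(y-\tfrac{\pi}{5}\Big|\tau\right)\right)\left(\theta_1^5\!\left(x+\tfrac{2\pi}{5}\Big|\tau\right)-\theta_1^5\!\left(x-\tfrac{2\pi}{5}\Big|\tau\right)\right)\\ &=\left(250\eta^4(\tau)\eta^4(5\tau)+3125\frac{\eta^{10}(5\tau)}{\eta^2(\tau)}\right)\frac{\theta_1(x+y|\tau)\theta_1(x-y|\tau)\theta_1(2x|\tau)\theta_1(2y|\tau)}{\theta_1(x|\tau)\theta_1(y|\tau)}. \end{align*}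
   Context: $q=e^{2\pi i\tau}$, $q^a=e^{2\pi i a\tau}$; $\eta(\tau)=q^{1/24}\prod_{n\ge1}(1-q^n)$; $\theta_1(z|\tau)=2\sum_{n\ge0}(-1)^nq^{(2n+1)^2/8}\sin(2n+1)z$. *)

theory Defs
  imports "HOL-Analysis.Analysis"
begin

(* qpow \<tau> a is q^a for q = e^(2 pi i \<tau>), defined through \<tau> so that no branch of
   the power function is involved for fractional a. *)
definition qpow :: "complex \<Rightarrow> real \<Rightarrow> complex" where
  "qpow \<tau> a = exp (2 * of_real pi * \<i> * of_real a * \<tau>)"

(* The product over n >= 1 is indexed from 0. *)
definition dedekind_eta :: "complex \<Rightarrow> complex" where
  "dedekind_eta \<tau> = qpow \<tau> (1 / 24) * (\<Prod>n. 1 - qpow \<tau> (real (Suc n)))"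

definition theta1 :: "complex \<Rightarrow> complex \<Rightarrow> complex" where
  "theta1 z \<tau> =
     2 * (\<Sum>n. (-1) ^ n * qpow \<tau> ((2 * real n + 1)\<^sup>2 / 8) * sin ((2 * of_nat n + 1) * z))"

end

theory Submission
  imports Defs "HOL-Complex_Analysis.Complex_Analysis" "HOL-Real_Asymp.Real_Asymp"
begin

text \<open>
  Write \<open>\<theta> = \<theta>\<^sub>1(\<cdot>|\<tau>)\<close>, \<open>p = \<pi>/5\<close>, \<open>a = \<theta>(p)\<close>, \<open>b = \<theta>(2p)\<close>. As a function of \<open>x\<close>, the left-hand side
  times \<open>\<theta>(x)\<close> is an odd theta function of degree 6, hence vanishes at all half-periods; it also
  vanishes at \<open>x = \<plusminus>y\<close>. So its quotient by \<open>\<theta>(x+y) \<theta>(x-y) \<theta>(2x)\<close> is entire and doubly periodic, hence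
  constant in \<open>x\<close>. By antisymmetry the left-hand side is \<open>C\<close> times the theta quotient, and evaluation
  at \<open>x, y \<in> {p, 2p}\<close> gives \<open>C a b = b\<^sup>1\<^sup>0 - a\<^sup>5 b\<^sup>5 - a\<^sup>1\<^sup>0\<close>.

  The triple product gives \<open>(ab)\<^sup>2 = 5 \<eta>(\<tau>)\<^sup>2 \<eta>(5\<tau>)\<^sup>2\<close>, so it remains to see that
  \<open>\<eta>(\<tau>)\<^sup>1\<^sup>2 (b\<^sup>1\<^sup>0 - 11 a\<^sup>5 b\<^sup>5 - a\<^sup>1\<^sup>0) = a\<^sup>1\<^sup>1 b\<^sup>1\<^sup>1\<close>. This is the discriminant of the Tate normal form of an elliptic
  curve with a point of order 5: the values of \<open>\<theta>(x+p) \<theta>(x-p) / \<theta>(x)\<^sup>2\<close> at the three half-periods are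
  the roots of an explicit cubic over \<open>\<int>[a, b]\<close>, and their differences are theta products.
\<close>

section \<open>The Jacobi triple product\<close>

text \<open>Fifths of \<pi> matter because the multipliers of a theta function see its total shift
  only modulo \<pi>. The fifth powers at z + \<pi>/5, z - \<pi>/5, z + 2\<pi>/5, z - 2\<pi>/5
  therefore share their multipliers and may be subtracted, and \<theta>(\<pi> - z) = \<theta>(z)
  folds all multiples of \<pi>/5 onto the two values \<open>a\<close> and \<open>b\<close>. The
  recurring obstacle is multiplicity: F/G is known to be entire only if F vanishes at the zeros of G
  and those zeros are simple. For \<theta> itself this rests on \<theta>'(0) \<noteq> 0, hence the
  need for the derivative of the triple product at 0 besides the product itself. For \<theta>(x+y)
  \<theta>(x-y) \<theta>(2x) it rests on \<theta>(2y) \<noteq> 0; where that fails, both sides of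
  the identity vanish for a separate reason. The product a b itself involves the square root of 5,
  but only even powers of it occur, so its square is all that has to be known.\<close>

definition qfact :: "complex \<Rightarrow> nat \<Rightarrow> complex" where
  "qfact q n = (\<Prod>k<n. 1 - q ^ Suc k)"

definition euler_prod :: "complex \<Rightarrow> complex" where
  "euler_prod q = (\<Prod>n. 1 - q ^ Suc n)"

text \<open>Completing the square gives (2j+1)^2/8 = 1/8 + \<open>tri j\<close>, so that after the
  factor q^(1/8) the theta series has integral powers of q.\<close>

definition tri :: "nat \<Rightarrow> nat" where
  "tri j = j * Suc j div 2"

lemma tri_0 [simp]: "tri 0 = 0"
  by (simp add: tri_def)

lemma tri_Suc [simp]: "tri (Suc j) = tri j + Suc j"
proof -
  have "Suc j * Suc (Suc j) = j * Suc j + 2 * Suc j"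
    by simp
  then show ?thesis
    unfolding tri_def by (simp only:) simp
qed

lemma real_tri: "real (tri j) = real j * (real j + 1) / 2"
  by (induction j) (auto simp: field_simps)

lemma qfact_Suc: "qfact q (Suc n) = qfact q n * (1 - q ^ Suc n)"
  by (simp add: qfact_def)

lemma one_minus_power_neq_0:
  fixes q :: complex
  assumes "norm q < 1"
  shows "1 - q ^ Suc k \<noteq> 0"
proof
  assume "1 - q ^ Suc k = 0"
  then have "norm q ^ Suc k = 1"
    by (metis eq_iff_diff_eq_0 norm_one norm_power)
  moreover have "norm q ^ Suc k < 1"
    using power_decreasing[of 1 "Suc k" "norm q"] assms by simp
  ultimately show False
    by simp
qed

lemma qfact_neq_0:
  assumes "norm q < 1"
  shows "qfact q n \<noteq> 0"
  unfolding qfact_def using one_minus_power_neq_0[OF assms] by (simp add: prod_zero_iff)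

lemma convergent_prod_one_minus_power:
  fixes q w :: complex
  assumes "norm q < 1"
  shows "convergent_prod (\<lambda>n. 1 - q ^ Suc n * w)"
proof -
  have "summable (\<lambda>n. norm w * norm q * norm q ^ n)"
    using assms by (intro summable_mult summable_geometric) auto
  then have "summable (\<lambda>n. norm ((1 - q ^ Suc n * w) - 1))"
    by (simp add: norm_mult norm_power mult_ac)
  then show ?thesis
    by (intro abs_convergent_prod_imp_convergent_prod summable_imp_abs_convergent_prod)
qed

lemma convergent_prod_tendsto_lessThan:
  fixes f :: "nat \<Rightarrow> complex"
  assumes "convergent_prod f"
  shows "(\<lambda>n. \<Prod>k<n. f k) \<longlonglongrightarrow> prodinf f"
  using convergent_prod_LIMSEQ[OF assms]
  by (subst filterlim_sequentially_Suc[symmetric]) (simp add: lessThan_Suc_atMost)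

lemma qfact_tendsto:
  assumes "norm q < 1"
  shows "qfact q \<longlonglongrightarrow> euler_prod q"
  using convergent_prod_tendsto_lessThan[OF convergent_prod_one_minus_power[OF assms, of 1]]
  by (simp add: qfact_def[abs_def] euler_prod_def)

lemma euler_prod_neq_0:
  assumes "norm q < 1"
  shows "euler_prod q \<noteq> 0"
  using prodinf_nonzero[OF convergent_prod_one_minus_power[OF assms, of 1]]
    one_minus_power_neq_0[OF assms]
  by (simp add: euler_prod_def)

text \<open>The Gaussian binomial coefficient of 2n+1 over n-j. The odd upper index makes it
  symmetric under j -> -1-j, which is the symmetry that pairs exponentials into sines of odd
  multiples of z.\<close>

definition qcoeff :: "complex \<Rightarrow> nat \<Rightarrow> nat \<Rightarrow> complex" where
  "qcoeff q n j =
     (if j \<le> n then qfact q (2 * n + 1) / (qfact q (n - j) * qfact q (n + 1 + j)) else 0)"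

lemma qcoeff_eq_0 [simp]: "n < j \<Longrightarrow> qcoeff q n j = 0"
  by (simp add: qcoeff_def)

lemma qcoeff_add: "qcoeff q (j + m) j = qfact q (2 * j + 2 * m + 1) / (qfact q m * qfact q (2 * j + m +
    1))"
  by (simp add: qcoeff_def mult_2 add_ac)

text \<open>The edge of the recurrence in \<open>qcoeff_rec_Suc\<close>: the neighbour with index -1
  equals the coefficient with index 0 by symmetry, which produces the term q^(n+1)
  \<open>qcoeff q n 0\<close>.\<close>

lemma qcoeff_rec_0:
  assumes q: "norm q < 1"
  shows "qcoeff q (Suc n) 0 = (1 + q ^ (2 * n + 2)) * qcoeff q n 0 + q ^ (n + 1) * qcoeff q n 0
           + q ^ (n + 2) * qcoeff q n 1"
proof (cases n)
  case 0
  have nz: "1 - q \<noteq> 0" "1 - q * q \<noteq> 0"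
    using one_minus_power_neq_0[OF q, of 0] one_minus_power_neq_0[OF q, of 1] by simp_all
  have "qcoeff q 1 0 = 1 + q + q * q"
  proof -
    have "qcoeff q 1 0 = (1 - q * (q * q)) / (1 - q)"
      using nz by (simp add: qcoeff_def qfact_def lessThan_Suc eval_nat_numeral)
    moreover have "1 - q * (q * q) = (1 - q) * (1 + q + q * q)"
      by (simp add: algebra_simps)
    ultimately show ?thesis
      using nz by simp
  qed
  then show ?thesis
    using nz by (simp add: 0 qcoeff_def qfact_def lessThan_Suc eval_nat_numeral)
next
  case (Suc m)
  define X where "X = q ^ Suc m"
  define A where "A = qfact q m"
  define B where "B = qfact q (m + 2)"
  define P where "P = qfact q (2 * m + 3)"
  \<comment> \<open>A common factor of all the coefficients involved; after extracting it, a
    polynomial identity in q and X remains.\<close>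
  define K where "K = P / (A * (1 - X) * (1 - q * X) * B * (1 - q * (q * X)))"
  have nz: "A \<noteq> 0" "B \<noteq> 0" "1 - X \<noteq> 0" "1 - q * X \<noteq> 0" "1 - q * (q * X)
      \<noteq> 0"
    using qfact_neq_0[OF q] one_minus_power_neq_0[OF q, of m]
      one_minus_power_neq_0[OF q, of "Suc m"] one_minus_power_neq_0[OF q, of "Suc (Suc m)"]
    by (auto simp: A_def B_def X_def)
  have "qcoeff q n 0 = P / (A * (1 - X) * B)"
    using Suc qcoeff_add[of q 0 "m + 1"]
    by (simp add: A_def B_def P_def X_def qfact_Suc eval_nat_numeral)
  also have "\<dots> = K * ((1 - q * X) * (1 - q * (q * X)))"
    using nz by (simp add: K_def)
  finally have e1: "qcoeff q n 0 = K * ((1 - q * X) * (1 - q * (q * X)))" .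
  have "qcoeff q n 1 = P / (A * (B * (1 - q * (q * X))))"
    using Suc qcoeff_add[of q 1 m]
    by (simp add: A_def B_def P_def X_def qfact_Suc eval_nat_numeral)
  also have "\<dots> = K * ((1 - X) * (1 - q * X))"
    using nz by (simp add: K_def)
  finally have e2: "qcoeff q n 1 = K * ((1 - X) * (1 - q * X))" .
  have "qfact q (2 * m + 5) = P * (1 - q * (q * (X * X))) * (1 - q * (q * (q * (X * X))))"
    by (simp add: P_def X_def qfact_Suc eval_nat_numeral power_add mult_2 mult_ac)
  moreover have "qfact q (m + 2) = A * (1 - X) * (1 - q * X)"
    by (simp add: A_def X_def qfact_Suc eval_nat_numeral)
  moreover have "qfact q (m + 3) = B * (1 - q * (q * X))"
    by (simp add: B_def X_def qfact_Suc eval_nat_numeral)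
  ultimately have e3: "qcoeff q (Suc n) 0 = K * ((1 - q * (q * (X * X))) * (1 - q * (q * (q * (X *
      X)))))"
    using Suc qcoeff_add[of q 0 "m + 2"] by (simp add: K_def mult_ac numeral_eq_Suc)
  have pw: "q ^ (2 * n + 2) = q * q * X * X" "q ^ (n + 1) = q * X" "q ^ (n + 2) = q * q * X"
    by (simp_all add: Suc X_def eval_nat_numeral power_add mult_2 mult_ac)
  show ?thesis
    unfolding e1 e2 e3 pw by (simp add: algebra_simps)
qed

text \<open>The q-Pascal rule applied twice, since the upper index grows by 2. The cases n = j, n =
  j+1 and n \<ge> j+2 differ in how many of the coefficients on the right are cut off to 0.\<close>

lemma qcoeff_rec_Suc:
  assumes q: "norm q < 1" and "j \<le> n"
  shows "qcoeff q (Suc n) (Suc j) = (1 + q ^ (2 * n + 2)) * qcoeff q n (Suc j)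
           + q ^ (n - j) * qcoeff q n j + q ^ (n + j + 3) * qcoeff q n (Suc (Suc j))"
proof -
  consider "n = j" | "n = Suc j" | m where "n = Suc (Suc j) + m"
    using \<open>j \<le> n\<close> by (metis Suc_leI le_Suc_ex le_neq_implies_less)
  then show ?thesis
  proof cases
    case 1
    have "qcoeff q (Suc j) (Suc j) = 1" "qcoeff q j j = 1"
      using qcoeff_add[of q "Suc j" 0] qcoeff_add[of q j 0] qfact_neq_0[OF q] 
      by (simp_all add: qfact_def[of q 0])
    with 1 show ?thesis
      by simp
  next
    case 2
    define Y where "Y = q ^ (2 * j + 3)"
    define B where "B = qfact q (2 * j + 2)"
    define K where "K = 1 / (1 - q)"
    have nz: "1 - Y \<noteq> 0" "1 - q * Y \<noteq> 0" "1 - q \<noteq> 0" "B \<noteq> 0"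
      using one_minus_power_neq_0[OF q, of "2 * j + 2"] one_minus_power_neq_0[OF q, of "2 * j + 3"]
        one_minus_power_neq_0[OF q, of 0] qfact_neq_0[OF q]
      by (simp_all add: Y_def B_def eval_nat_numeral)
    have f: "qfact q 0 = 1" "qfact q 1 = 1 - q" "qfact q (2 * j + 3) = B * (1 - Y)"
       "qfact q (2 * j + 4) = B * (1 - Y) * (1 - q * Y)"
       "qfact q (2 * j + 5) = B * (1 - Y) * (1 - q * Y) * (1 - q * (q * Y))"
      by (simp_all add: B_def Y_def qfact_Suc eval_nat_numeral) (simp_all add: qfact_def)
    have e1: "qcoeff q n (Suc j) = K * (1 - q)"
      using qcoeff_add[of q "Suc j" 0] nz f by (simp add: 2 K_def numeral_eq_Suc)
    have e2: "qcoeff q n j = K * (1 - Y)"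
      using qcoeff_add[of q j 1] nz f by (simp add: 2 K_def numeral_eq_Suc B_def)
    have e3: "qcoeff q (Suc n) (Suc j) = K * (1 - q * (q * Y))"
      using qcoeff_add[of q "Suc j" 1] nz f by (simp add: 2 K_def numeral_eq_Suc)
    have pw: "q ^ (2 * n + 2) = q * Y" "q ^ (n - j) = q"
      by (simp_all add: 2 Y_def eval_nat_numeral)
    show ?thesis
      unfolding e1 e2 e3 pw by (simp add: 2 algebra_simps)
  next
    case (3 m)
    define X where "X = q ^ Suc m"
    define Y where "Y = q ^ (2 * j + m + 4)"
    define A where "A = qfact q m"
    define B where "B = qfact q (2 * j + m + 3)"
    define P where "P = qfact q (2 * j + 2 * m + 5)"
    define K where "K = P / (A * (1 - X) * (1 - q * X) * B * (1 - Y) * (1 - q * Y))"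
    have nz: "A \<noteq> 0" "B \<noteq> 0" "1 - X \<noteq> 0" "1 - q * X \<noteq> 0" "1 - Y \<noteq> 0"
        "1 - q * Y \<noteq> 0"
      using qfact_neq_0[OF q] one_minus_power_neq_0[OF q, of m]
        one_minus_power_neq_0[OF q, of "Suc m"] one_minus_power_neq_0[OF q, of "2 * j + m + 3"]
        one_minus_power_neq_0[OF q, of "2 * j + m + 4"]
      by (auto simp: A_def B_def X_def Y_def eval_nat_numeral)
    have f: "qfact q (m + 1) = A * (1 - X)" "qfact q (m + 2) = A * (1 - X) * (1 - q * X)"
      "qfact q (2 * j + m + 4) = B * (1 - Y)" "qfact q (2 * j + m + 5) = B * (1 - Y) * (1 - q * Y)"
      "qfact q (2 * j + 2 * m + 7) = P * (1 - q * (X * Y)) * (1 - q * (q * (X * Y)))"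
      by (simp_all add: A_def B_def P_def X_def Y_def qfact_Suc eval_nat_numeral power_add mult_2
          mult_ac)
    have e1: "qcoeff q n (Suc j) = K * ((1 - q * X) * (1 - q * Y))"
      using qcoeff_add[of q "Suc j" "m + 1"] f nz by (simp add: 3 K_def P_def numeral_eq_Suc mult_ac)
    have e2: "qcoeff q n j = K * ((1 - Y) * (1 - q * Y))"
      using qcoeff_add[of q j "m + 2"] f nz by (simp add: 3 K_def P_def B_def numeral_eq_Suc)
    have e3: "qcoeff q n (Suc (Suc j)) = K * ((1 - X) * (1 - q * X))"
      using qcoeff_add[of q "Suc (Suc j)" m] f nz by (simp add: 3 K_def P_def A_def numeral_eq_Suc)
    have e4: "qcoeff q (Suc n) (Suc j) = K * ((1 - q * (X * Y)) * (1 - q * (q * (X * Y))))"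
      using qcoeff_add[of q "Suc j" "m + 2"] f nz by (simp add: 3 K_def P_def numeral_eq_Suc mult_ac)
    have pw: "q ^ (2 * n + 2) = q * X * Y" "q ^ (n - j) = q * X" "q ^ (n + j + 3) = q * Y"
      by (simp_all add: 3 X_def Y_def eval_nat_numeral power_add mult_2 mult_ac)
    show ?thesis
      unfolding e1 e2 e3 e4 pw by (simp add: algebra_simps)
  qed
qed

text \<open>With this sign and this power of q both neighbours in the recurrence get the same
  coefficient -q^(n+1), so that passing from n to n+1 multiplies the series by 1 - \<kappa> q^(n+1)
  + q^(2n+2).\<close>

definition qterm :: "complex \<Rightarrow> nat \<Rightarrow> nat \<Rightarrow> complex" where
  "qterm q n j = (-1) ^ j * q ^ tri j * qcoeff q n j"

lemma qterm_eq_0 [simp]: "n < j \<Longrightarrow> qterm q n j = 0"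
  by (simp add: qterm_def)

lemma qterm_rec_0:
  assumes "norm q < 1"
  shows "qterm q (Suc n) 0 = (1 + q ^ (2 * n + 2)) * qterm q n 0
           - q ^ (n + 1) * (qterm q n 1 - qterm q n 0)"
  using qcoeff_rec_0[OF assms, of n] by (simp add: qterm_def algebra_simps)

lemma qterm_rec_Suc:
  assumes "norm q < 1"
  shows "qterm q (Suc n) (Suc j) = (1 + q ^ (2 * n + 2)) * qterm q n (Suc j)
           - q ^ (n + 1) * (qterm q n j + qterm q n (Suc (Suc j)))"
proof (cases "j \<le> n")
  case True
  have "q ^ tri (Suc j) * q ^ (n - j) = q ^ (n + 1) * q ^ tri j"
    using True by (simp add: power_add[symmetric] add.commute)
  moreover have "q ^ tri (Suc j) * q ^ (n + j + 3) = q ^ (n + 1) * q ^ tri (Suc (Suc j))"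
    by (simp add: power_add[symmetric] eval_nat_numeral add_ac)
  ultimately show ?thesis
    unfolding qterm_def qcoeff_rec_Suc[OF assms True]
    by (simp add: ring_distribs power_Suc[of "-1"] mult.assoc del: tri_Suc power_Suc) 
       (simp add: algebra_simps del: tri_Suc)
next
  case False
  then show ?thesis
    by simp
qed

text \<open>With \<open>\<sigma> j = sin ((2j+1)z)\<close> and \<open>\<kappa> = 2 cos (2z)\<close> this is a finite form of the triple
  product; \<open>\<sigma> j = 2j+1\<close> and \<open>\<kappa> = 2\<close> give its derivative at \<open>z = 0\<close>.\<close>

lemma sum_qterm_eq_prod:
  fixes \<sigma> :: "nat \<Rightarrow> complex"
  assumes q: "norm q < 1"
    and s0: "\<kappa> * \<sigma> 0 = \<sigma> 1 - \<sigma> 0"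
    and sS: "\<And>j. \<kappa> * \<sigma> (Suc j) = \<sigma> (Suc (Suc j)) + \<sigma> j"
  shows "n < N \<Longrightarrow> (\<Sum>j<N. qterm q n j * \<sigma> j)
           = \<sigma> 0 * (\<Prod>k<n. 1 - \<kappa> * q ^ Suc k + q ^ (2 * Suc k))"
proof (induction n arbitrary: N)
  case 0
  then obtain M where "N = Suc M"
    using not0_implies_Suc by blast
  moreover have "qterm q 0 0 = 1"
    using one_minus_power_neq_0[OF q, of 0] by (simp add: qterm_def qcoeff_def qfact_def)
  ultimately show ?case
    by (simp add: sum.lessThan_Suc_shift del: sum.lessThan_Suc)
next
  case (Suc n)
  then obtain M where N: "N = Suc M" and M: "n < M"
    by (metis Suc_lessE)
  define T where "T = qterm q n"
  define X where "X = (\<Sum>j<M. T j * \<sigma> (Suc j))"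
  define Y where "Y = (\<Sum>j<M. T (Suc (Suc j)) * \<sigma> (Suc j))"
  define Z where "Z = (\<Sum>j<M. T (Suc j) * \<sigma> (Suc j))"
  have S: "(\<Sum>j<N. T j * \<sigma> j) = T 0 * \<sigma> 0 + Z"
    unfolding N Z_def by (simp add: sum.lessThan_Suc_shift del: sum.lessThan_Suc)
  have "(\<Sum>j<Suc M. T j * \<sigma> (Suc j)) = X"
    using M by (simp add: X_def T_def)
  then have X: "T 0 * \<sigma> 1 + (\<Sum>j<M. T (Suc j) * \<sigma> (Suc (Suc j))) = X"
    by (simp add: sum.lessThan_Suc_shift del: sum.lessThan_Suc)
  have "(\<Sum>j<Suc M. T (Suc j) * \<sigma> j) = (\<Sum>j<M. T (Suc j) * \<sigma> j)"
    using M by (simp add: T_def)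
  then have Y: "T 1 * \<sigma> 0 + Y = (\<Sum>j<M. T (Suc j) * \<sigma> j)"
    by (simp add: sum.lessThan_Suc_shift Y_def del: sum.lessThan_Suc)
  have "\<kappa> * Z = (\<Sum>j<M. T (Suc j) * (\<kappa> * \<sigma> (Suc j)))"
    by (simp add: Z_def sum_distrib_left mult_ac)
  also have "\<dots> = (\<Sum>j<M. T (Suc j) * \<sigma> (Suc (Suc j))) + (\<Sum>j<M. T (Suc j) *
      \<sigma> j)"
    by (simp add: sS ring_distribs sum.distrib)
  also have "\<dots> = X - T 0 * \<sigma> 1 + T 1 * \<sigma> 0 + Y"
    by (simp add: X[symmetric] Y[symmetric])
  finally have Z: "\<kappa> * Z = X - T 0 * \<sigma> 1 + T 1 * \<sigma> 0 + Y" .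
  have "(\<Sum>j<M. qterm q (Suc n) (Suc j) * \<sigma> (Suc j))
      = (\<Sum>j<M. (1 + q ^ (2 * n + 2)) * (T (Suc j) * \<sigma> (Suc j))
          - q ^ (n + 1) * (T j * \<sigma> (Suc j) + T (Suc (Suc j)) * \<sigma> (Suc j)))"
    by (intro sum.cong) (simp_all add: qterm_rec_Suc[OF q] T_def algebra_simps)
  also have "\<dots> = (1 + q ^ (2 * n + 2)) * Z - q ^ (n + 1) * (X + Y)"
    by (simp add: X_def Y_def Z_def sum_subtractf sum.distrib flip: sum_distrib_left)
  finally have "(\<Sum>j<N. qterm q (Suc n) j * \<sigma> j)
      = qterm q (Suc n) 0 * \<sigma> 0 + ((1 + q ^ (2 * n + 2)) * Z - q ^ (n + 1) * (X + Y))"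
    unfolding N by (simp add: sum.lessThan_Suc_shift del: sum.lessThan_Suc)
  \<comment> \<open>The terms are regrouped so that the first bracket becomes \<kappa> \<sigma> 0 by
    \<open>s0\<close> and the second \<kappa> Z; the boundary terms of the index shifts cancel
    exactly.\<close>
  also have "\<dots> = (T 0 * \<sigma> 0 + Z) * (1 + q ^ (2 * n + 2))
      - q ^ (n + 1) * (T 0 * (\<sigma> 1 - \<sigma> 0) + (X - T 0 * \<sigma> 1 + T 1 * \<sigma> 0 + Y))"
    by (simp add: qterm_rec_0[OF q] T_def[symmetric] algebra_simps)
  also have "\<dots> = (T 0 * \<sigma> 0 + Z) * (1 - \<kappa> * q ^ Suc n + q ^ (2 * Suc n))"
    unfolding Z[symmetric] s0[symmetric] by (simp add: algebra_simps)
  also have "T 0 * \<sigma> 0 + Z = \<sigma> 0 * (\<Prod>k<n. 1 - \<kappa> * q ^ Suc k + q ^ (2 * Suc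
      k))"
    using Suc.IH[of N] M unfolding S[symmetric] by (simp add: N T_def)
  finally show ?case
    by simp
qed

section \<open>Passage to the limit in the finite triple product\<close>

lemma qcoeff_tendsto:
  assumes q: "norm q < 1"
  shows "(\<lambda>n. qcoeff q n j) \<longlonglongrightarrow> 1 / euler_prod q"
proof -
  have lims: "filterlim (\<lambda>n::nat. 2 * n + 1) sequentially sequentially"
    "filterlim (\<lambda>n::nat. n - j) sequentially sequentially"
    "filterlim (\<lambda>n::nat. n + 1 + j) sequentially sequentially"
    by real_asymp+
  have "(\<lambda>n. qfact q (2 * n + 1) / (qfact q (n - j) * qfact q (n + 1 + j)))
      \<longlonglongrightarrow> euler_prod q / (euler_prod q * euler_prod q)"
    using euler_prod_neq_0[OF q]
    by (intro tendsto_intros filterlim_compose[OF qfact_tendsto[OF q]] lims) auto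
  moreover have "eventually (\<lambda>n. qfact q (2 * n + 1) / (qfact q (n - j) * qfact q (n + 1 + j))
      = qcoeff q n j) sequentially"
    using eventually_ge_at_top[of j] by eventually_elim (simp add: qcoeff_def)
  ultimately have "(\<lambda>n. qcoeff q n j) \<longlonglongrightarrow> euler_prod q / (euler_prod q *
      euler_prod q)"
    by (rule Lim_transform_eventually)
  then show ?thesis
    using euler_prod_neq_0[OF q] by simp
qed

text \<open>The bound is uniform in both indices, as the majorant in Tannery's theorem requires. It
  exists because \<open>qfact q\<close> and its inverse both converge.\<close>

lemma qcoeff_bounded:
  assumes q: "norm q < 1"
  obtains M where "\<And>n j. norm (qcoeff q n j) \<le> M" "M > 0"
proof -
  have "Bseq (qfact q)"
    using qfact_tendsto[OF q] convergent_imp_Bseq convergentI by blast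
  then obtain A where A: "A > 0" "\<And>n. norm (qfact q n) \<le> A"
    by (metis BseqE)
  have "(\<lambda>n. inverse (qfact q n)) \<longlonglongrightarrow> inverse (euler_prod q)"
    using qfact_tendsto[OF q] euler_prod_neq_0[OF q] by (rule tendsto_inverse)
  then have "Bseq (\<lambda>n. inverse (qfact q n))"
    using convergent_imp_Bseq convergentI by blast
  then obtain B where B: "B > 0" "\<And>n. norm (inverse (qfact q n)) \<le> B"
    by (metis BseqE)
  have "norm (qcoeff q n j) \<le> A * (B * B)" for n j
  proof (cases "j \<le> n")
    case True
    then have "norm (qcoeff q n j) = norm (qfact q (2 * n + 1))
        * (norm (inverse (qfact q (n - j))) * norm (inverse (qfact q (n + 1 + j))))"
      by (simp add: qcoeff_def norm_mult norm_divide norm_inverse divide_simps)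
    also have "\<dots> \<le> A * (B * B)"
      using A B by (intro mult_mono) auto
    finally show ?thesis .
  qed (use A B in auto)
  then show ?thesis
    using that[of "A * (B * B)"] A(1) B(1) by simp
qed

text \<open>The limit n -> \<infinity> of \<open>sum_qterm_eq_prod\<close>. Each coefficient tends
  to 1 / \<open>euler_prod q\<close>, which the factor \<open>euler_prod q\<close> cancels.\<close>

lemma prod_tendsto_theta_series:
  fixes \<sigma> :: "nat \<Rightarrow> complex"
  assumes q: "norm q < 1"
    and s0: "\<kappa> * \<sigma> 0 = \<sigma> 1 - \<sigma> 0"
    and sS: "\<And>j. \<kappa> * \<sigma> (Suc j) = \<sigma> (Suc (Suc j)) + \<sigma> j"
    and summ: "summable (\<lambda>j. norm (q ^ tri j * \<sigma> j))"
  shows "(\<lambda>n. euler_prod q * \<sigma> 0 * (\<Prod>k<n. 1 - \<kappa> * q ^ Suc k + q ^ (2 * Suc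
      k)))
           \<longlonglongrightarrow> (\<Sum>j. (-1) ^ j * q ^ tri j * \<sigma> j)"
proof -
  obtain M where M: "\<And>n j. norm (qcoeff q n j) \<le> M" "M > 0"
    using qcoeff_bounded[OF q] by metis
  let ?E = "euler_prod q"
  have "((\<lambda>n. \<Sum>j. ?E * (qterm q n j * \<sigma> j)) \<longlongrightarrow> (\<Sum>j. (-1) ^
      j * q ^ tri j * \<sigma> j)) sequentially"
  proof (rule tannerys_theorem[THEN conjunct2, THEN conjunct2])
    fix j
    have "(\<lambda>n. ?E * ((-1) ^ j * q ^ tri j * qcoeff q n j * \<sigma> j))
        \<longlonglongrightarrow> ?E * ((-1) ^ j * q ^ tri j * (1 / ?E) * \<sigma> j)"
      by (intro tendsto_intros qcoeff_tendsto[OF q])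
    then show "(\<lambda>n. ?E * (qterm q n j * \<sigma> j)) \<longlonglongrightarrow> (-1) ^ j * q ^
        tri j * \<sigma> j"
      using euler_prod_neq_0[OF q] by (simp add: qterm_def)
  next
    have "norm (?E * (qterm q n j * \<sigma> j)) \<le> norm ?E * M * norm (q ^ tri j * \<sigma> j)" for
        n j
    proof -
      have "norm (?E * (qterm q n j * \<sigma> j)) = norm ?E * norm (qcoeff q n j) * norm (q ^ tri j *
          \<sigma> j)"
        by (simp add: qterm_def norm_mult norm_power)
      also have "\<dots> \<le> norm ?E * M * norm (q ^ tri j * \<sigma> j)"
        using M by (intro mult_mono) auto
      finally show ?thesis .
    qed
    then show "\<forall>\<^sub>F (j, n) in sequentially \<times>\<^sub>F sequentially.
        norm (?E * (qterm q n j * \<sigma> j)) \<le> norm ?E * M * norm (q ^ tri j * \<sigma> j)"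
      by (intro always_eventually) auto
  next
    show "summable (\<lambda>j. norm ?E * M * norm (q ^ tri j * \<sigma> j))"
      by (intro summable_mult summ)
  qed simp
  moreover have "(\<Sum>j. ?E * (qterm q n j * \<sigma> j))
      = ?E * \<sigma> 0 * (\<Prod>k<n. 1 - \<kappa> * q ^ Suc k + q ^ (2 * Suc k))" for n
  proof -
    have "(\<Sum>j. ?E * (qterm q n j * \<sigma> j)) = (\<Sum>j<Suc n. ?E * (qterm q n j * \<sigma> j))"
      by (rule suminf_finite) auto
    also have "\<dots> = ?E * (\<Sum>j<Suc n. qterm q n j * \<sigma> j)"
      by (simp only: sum_distrib_left)
    finally show ?thesis
      using sum_qterm_eq_prod[OF q s0 sS, of n "Suc n"] by (simp only: mult.assoc lessI)
  qed
  ultimately show ?thesis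
    by simp
qed

text \<open>The quadratic exponent beats every K^j: consecutive terms have the ratio r^(j+1) K,
  which tends to 0.\<close>

lemma summable_tri_power:
  fixes r K :: real
  assumes "0 \<le> r" "r < 1" "0 \<le> K"
  shows "summable (\<lambda>j. r ^ tri j * K ^ j)"
proof -
  have "(\<lambda>j. r ^ Suc j * K) \<longlonglongrightarrow> 0 * K"
    using assms by (intro tendsto_mult tendsto_const LIMSEQ_Suc[OF LIMSEQ_realpow_zero]) auto
  then have "eventually (\<lambda>j. r ^ Suc j * K < 1 / 2) sequentially"
    by (rule order_tendstoD) simp
  then obtain N where N: "\<And>j. j \<ge> N \<Longrightarrow> r ^ Suc j * K < 1 / 2"
    by (auto simp: eventually_sequentially)
  show ?thesis
  proof (rule summable_ratio_test[of "1 / 2" N])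
    fix j assume "N \<le> j"
    have "norm (r ^ tri (Suc j) * K ^ Suc j) = (r ^ Suc j * K) * (r ^ tri j * K ^ j)"
      using assms by (simp add: power_add mult_ac)
    also have "\<dots> \<le> 1 / 2 * (r ^ tri j * K ^ j)"
      using N[OF \<open>N \<le> j\<close>] assms by (intro mult_right_mono) auto
    finally show "norm (r ^ tri (Suc j) * K ^ Suc j) \<le> 1 / 2 * norm (r ^ tri j * K ^ j)"
      using assms by simp
  qed simp
qed

lemma summable_tri_exp:
  fixes r :: real
  assumes "0 \<le> r" "r < 1"
  shows "summable (\<lambda>j. r ^ tri j * exp ((2 * real j + 1) * R))"
proof -
  have "summable (\<lambda>j. exp R * (r ^ tri j * exp (2 * R) ^ j))"
    using assms by (intro summable_mult summable_tri_power) auto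
  moreover have "exp R * (r ^ tri j * exp (2 * R) ^ j) = r ^ tri j * exp ((2 * real j + 1) * R)" for j
    by (simp add: exp_of_nat_mult[symmetric] exp_add[symmetric] algebra_simps)
  ultimately show ?thesis
    by simp
qed

lemma norm_sin_le_exp: "norm (sin (z::complex)) \<le> exp (norm z)"
proof -
  have "norm (sin z) = norm (exp (\<i> * z) - exp (- (\<i> * z))) / 2"
    by (simp add: sin_exp_eq norm_divide norm_mult)
  also have "\<dots> \<le> (norm (exp (\<i> * z)) + norm (exp (- (\<i> * z)))) / 2"
    by (intro divide_right_mono norm_triangle_ineq4) simp
  also have "\<dots> \<le> (exp (norm z) + exp (norm z)) / 2"
    using norm_exp[of "\<i> * z"] norm_exp[of "- (\<i> * z)"]
    by (intro divide_right_mono add_mono) (simp_all add: norm_mult)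
  finally show ?thesis
    by simp
qed

section \<open>Basic properties of the theta function\<close>

lemma qpow_add: "qpow \<tau> (a + b) = qpow \<tau> a * qpow \<tau> b"
  by (simp add: qpow_def exp_add[symmetric] algebra_simps)

lemma qpow_power: "qpow \<tau> a ^ n = qpow \<tau> (real n * a)"
  by (simp add: qpow_def exp_of_nat_mult[symmetric] mult_ac)

lemma qpow_nat: "qpow \<tau> (real n) = qpow \<tau> 1 ^ n"
  by (simp add: qpow_power)

lemma qpow_neq_0 [simp]: "qpow \<tau> a \<noteq> 0"
  by (simp add: qpow_def)

lemma norm_qpow_1_less_1:
  assumes "Im \<tau> > 0"
  shows "norm (qpow \<tau> 1) < 1"
  using assms by (simp add: qpow_def)

lemma qpow_theta_exponent: "qpow \<tau> ((2 * real n + 1)\<^sup>2 / 8) = qpow \<tau> (1 / 8) * qpow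
    \<tau> 1 ^ tri n"
proof -
  have "(2 * real n + 1)\<^sup>2 / 8 = 1 / 8 + real (tri n)"
    by (simp add: real_tri power2_eq_square field_simps)
  then show ?thesis
    by (simp only: qpow_add qpow_nat)
qed

lemma theta1_eq:
  "theta1 z \<tau> = 2 * (\<Sum>n. qpow \<tau> (1 / 8) * ((-1) ^ n * qpow \<tau> 1 ^ tri n * sin ((2 *
      of_nat n + 1) * z)))"
  unfolding theta1_def qpow_theta_exponent by (simp add: mult_ac)

lemma summable_theta_term:
  fixes q :: complex
  assumes "norm q < 1"
  shows "summable (\<lambda>j. norm (q ^ tri j * sin ((2 * of_nat j + 1) * z)))"
proof (rule summable_comparison_test)
  show "summable (\<lambda>j. norm q ^ tri j * exp ((2 * real j + 1) * norm z))"
    using assms by (intro summable_tri_exp) auto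
  have "norm (q ^ tri j * sin ((2 * of_nat j + 1) * z)) \<le> norm q ^ tri j * exp ((2 * real j + 1) *
      norm z)" for j
  proof -
    have "norm (2 * of_nat j + 1 :: complex) = 2 * real j + 1"
      using norm_of_nat[of "2 * j + 1", where 'a = complex] by (simp add: add_ac)
    then show ?thesis
      using norm_sin_le_exp[of "(2 * of_nat j + 1) * z"]
      by (simp add: norm_mult norm_power mult_left_mono)
  qed
  then show "\<exists>N. \<forall>n\<ge>N. norm (norm (q ^ tri n * sin ((2 * of_nat n + 1) * z)))
      \<le> norm q ^ tri n * exp ((2 * real n + 1) * norm z)"
    by auto
qed

lemma theta1_eq_suminf:
  assumes "Im \<tau> > 0"
  shows "theta1 z \<tau> = 2 * qpow \<tau> (1 / 8) * (\<Sum>n. (-1) ^ n * qpow \<tau> 1 ^ tri n * sin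
      ((2 * of_nat n + 1) * z))"
proof -
  have "summable (\<lambda>n. norm ((-1) ^ n * qpow \<tau> 1 ^ tri n * sin ((2 * of_nat n + 1) * z)))"
    using summable_theta_term[OF norm_qpow_1_less_1[OF assms], of z] by (simp add: norm_mult norm_power)
  then show ?thesis
    unfolding theta1_eq by (simp add: suminf_mult summable_norm_cancel)
qed

lemma theta1_prod_tendsto:
  assumes "Im \<tau> > 0"
  defines "q \<equiv> qpow \<tau> 1"
  shows "(\<lambda>n. 2 * qpow \<tau> (1 / 8) * euler_prod q * sin z
            * (\<Prod>k<n. 1 - 2 * cos (2 * z) * q ^ Suc k + q ^ (2 * Suc k)))
                \<longlonglongrightarrow> theta1 z \<tau>"
proof -
  have q: "norm q < 1"
    unfolding q_def by (rule norm_qpow_1_less_1[OF assms(1)])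
  have "(\<lambda>n. euler_prod q * sin ((2 * of_nat 0 + 1) * z)
            * (\<Prod>k<n. 1 - (2 * cos (2 * z)) * q ^ Suc k + q ^ (2 * Suc k)))
       \<longlonglongrightarrow> (\<Sum>j. (-1) ^ j * q ^ tri j * sin ((2 * of_nat j + 1) * z))"
  proof (rule prod_tendsto_theta_series[OF q])
    have "2 * cos (2 * z) * sin z = sin (z + 2 * z) + sin (z - 2 * z)"
      unfolding sin_add sin_diff by simp
    then show "2 * cos (2 * z) * sin ((2 * of_nat 0 + 1) * z)
        = sin ((2 * of_nat 1 + 1) * z) - sin ((2 * of_nat 0 + 1) * z)"
      by (simp add: algebra_simps)
  next
    fix j
    define u where "u = (2 * of_nat (Suc j) + 1) * z"
    have "2 * cos (2 * z) * sin u = sin (u + 2 * z) + sin (u - 2 * z)"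
      unfolding sin_add sin_diff by simp
    moreover have "u + 2 * z = (2 * of_nat (Suc (Suc j)) + 1) * z" "u - 2 * z = (2 * of_nat j + 1) * z"
      by (simp_all add: u_def algebra_simps)
    ultimately show "2 * cos (2 * z) * sin ((2 * of_nat (Suc j) + 1) * z)
        = sin ((2 * of_nat (Suc (Suc j)) + 1) * z) + sin ((2 * of_nat j + 1) * z)"
      by (simp add: u_def)
  qed (rule summable_theta_term[OF q])
  from tendsto_mult[OF tendsto_const[of "2 * qpow \<tau> (1 / 8)"] this] show ?thesis
    by (simp add: theta1_eq_suminf[OF assms(1)] q_def mult_ac)
qed

section \<open>Differentiation, parity and the period \<pi>\<close>

lemma theta1_has_field_derivative_suminf:
  assumes "Im \<tau> > 0"
  defines "q \<equiv> qpow \<tau> 1"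
  shows "((\<lambda>z. theta1 z \<tau>) has_field_derivative
      2 * (\<Sum>n. qpow \<tau> (1 / 8) * ((-1) ^ n * q ^ tri n * ((2 * of_nat n + 1) * cos ((2 *
          of_nat n + 1) * z)))))
      (at z)"
proof -
  have q: "norm q < 1"
    unfolding q_def by (rule norm_qpow_1_less_1[OF assms(1)])
  define R where "R = norm z + 1"
  \<comment> \<open>The extra 1 in \<open>R + 1\<close> absorbs the factor 2n+1 that differentiation
    brings out, by 2n+1 \<le> exp (2n+1).\<close>
  define M where "M n = norm (qpow \<tau> (1 / 8)) * (norm q ^ tri n * exp ((2 * real n + 1) * (R +
      1)))" for n
  let ?f = "\<lambda>n z. qpow \<tau> (1 / 8) * ((-1) ^ n * q ^ tri n * sin ((2 * of_nat n + 1) * z))"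
  let ?f' = "\<lambda>n z. qpow \<tau> (1 / 8) * ((-1) ^ n * q ^ tri n * ((2 * of_nat n + 1) * cos ((2
      * of_nat n + 1) * z)))"
  have "((\<lambda>x. \<Sum>n. ?f n x) has_field_derivative (\<Sum>n. ?f' n z)) (at z)"
  proof (rule has_field_derivative_series'(2)[of "ball 0 R"])
    show "(?f n has_field_derivative ?f' n x) (at x within ball 0 R)" for n x
      by (auto intro!: derivative_eq_intros simp: mult_ac)
    show "uniformly_convergent_on (ball 0 R) (\<lambda>n x. \<Sum>i<n. ?f' i x)"
    proof (rule Weierstrass_m_test')
      show "summable M"
        unfolding M_def using q by (intro summable_mult summable_tri_exp) auto
      fix n x assume "x \<in> ball (0::complex) R"
      then have x: "norm x \<le> R" by simp
      have N: "norm (2 * of_nat n + 1 :: complex) = 2 * real n + 1"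
        using norm_of_nat[of "2 * n + 1", where 'a = complex] by (simp add: add_ac)
      have "norm (cos ((2 * of_nat n + 1) * x)) \<le> exp ((2 * real n + 1) * R)"
        using norm_cos_le[of "(2 * of_nat n + 1) * x"] x
        by (elim order_trans) (auto simp: norm_mult N)
      then have "norm ((2 * of_nat n + 1) * cos ((2 * of_nat n + 1) * x))
          \<le> exp (2 * real n + 1) * exp ((2 * real n + 1) * R)"
        unfolding norm_mult N using exp_ge_add_one_self[of "2 * real n + 1"] by (intro mult_mono) auto
      also have "\<dots> = exp ((2 * real n + 1) * (R + 1))"
        by (simp add: exp_add[symmetric] algebra_simps)
      finally show "norm (?f' n x) \<le> M n"
        unfolding M_def norm_mult[of "qpow \<tau> (1 / 8)"] norm_mult[of "(-1) ^ n * q ^ tri n"]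
        by (intro mult_left_mono) (auto simp: norm_mult[of "(-1) ^ n"] norm_power mult_left_mono)
    qed
    show "z \<in> interior (ball 0 R)" "(0::complex) \<in> ball 0 R"
      by (auto simp: R_def add_nonneg_pos)
  qed auto
  from DERIV_cmult[OF this, of 2] show ?thesis
    unfolding theta1_eq[abs_def] q_def .
qed

lemma theta1_holomorphic:
  assumes "Im \<tau> > 0"
  shows "(\<lambda>z. theta1 z \<tau>) holomorphic_on UNIV"
  using theta1_has_field_derivative_suminf[OF assms]
  by (auto simp: holomorphic_on_def field_differentiable_def)

lemma summable_theta_coeff:
  fixes q :: complex
  assumes "norm q < 1"
  shows "summable (\<lambda>j. norm (q ^ tri j * (2 * of_nat j + 1)))"
proof (rule summable_comparison_test)
  show "summable (\<lambda>j. norm q ^ tri j * exp ((2 * real j + 1) * 1))"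
    using assms by (intro summable_tri_exp) auto
  have "norm (q ^ tri j * (2 * of_nat j + 1)) \<le> norm q ^ tri j * exp ((2 * real j + 1) * 1)" for j
  proof -
    have "norm (2 * of_nat j + 1 :: complex) = 2 * real j + 1"
      using norm_of_nat[of "2 * j + 1", where 'a = complex] by (simp add: add_ac)
    then show ?thesis
      using exp_ge_add_one_self[of "2 * real j + 1"]
      unfolding norm_mult norm_power by (intro mult_left_mono) auto
  qed
  then show "\<exists>N. \<forall>n\<ge>N. norm (norm (q ^ tri n * (2 * of_nat n + 1)))
      \<le> norm q ^ tri n * exp ((2 * real n + 1) * 1)"
    by auto
qed

text \<open>Jacobi's series for the cube of the Euler product: for \<kappa> = 2 each factor of the
  triple product is the square of 1 - q^(k+1). Since the value is not 0, the zero of \<theta> at 0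
  is simple.\<close>

lemma deriv_theta1_0:
  assumes "Im \<tau> > 0"
  defines "q \<equiv> qpow \<tau> 1"
  shows "deriv (\<lambda>z. theta1 z \<tau>) 0 = 2 * qpow \<tau> (1 / 8) * euler_prod q ^ 3"
proof -
  have q: "norm q < 1"
    unfolding q_def by (rule norm_qpow_1_less_1[OF assms(1)])
  have "(\<lambda>n. euler_prod q * (2 * of_nat 0 + 1) * (\<Prod>k<n. 1 - 2 * q ^ Suc k + q ^ (2 * Suc
      k)))
      \<longlonglongrightarrow> (\<Sum>j. (-1) ^ j * q ^ tri j * (2 * of_nat j + 1))"
  proof (rule prod_tendsto_theta_series[OF q, of 2 "\<lambda>j. 2 * of_nat j + 1"])
    show "2 * (2 * of_nat (Suc j) + 1) = (2 * of_nat (Suc (Suc j)) + 1) + (2 * of_nat j + 1 ::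
        complex)" for j
      by (simp add: algebra_simps)
  qed (simp_all only: summable_theta_coeff[OF q], simp)
  moreover have "(\<Prod>k<n. 1 - 2 * q ^ Suc k + q ^ (2 * Suc k)) = qfact q n ^ 2" for n
  proof -
    have "1 - 2 * q ^ Suc k + q ^ (2 * Suc k) = (1 - q ^ Suc k) ^ 2" for k
      using power_mult[of q "Suc k" 2] by (simp add: power2_diff mult.commute[of 2])
    then show ?thesis
      by (simp only: qfact_def prod_power_distrib)
  qed
  moreover have "(\<lambda>n. euler_prod q * (2 * of_nat 0 + 1) * qfact q n ^ 2)
      \<longlonglongrightarrow> euler_prod q * (2 * of_nat 0 + 1) * euler_prod q ^ 2"
    by (intro tendsto_intros qfact_tendsto[OF q])
  ultimately have "(\<Sum>j. (-1) ^ j * q ^ tri j * (2 * of_nat j + 1)) = euler_prod q * (2 * of_nat 0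
      + 1) * euler_prod q ^ 2"
    by (simp add: LIMSEQ_unique)
  then have *: "(\<Sum>j. (-1) ^ j * q ^ tri j * (2 * of_nat j + 1)) = euler_prod q ^ 3"
    by (simp add: power3_eq_cube power2_eq_square)
  have "summable (\<lambda>j. norm ((-1) ^ j * q ^ tri j * (2 * of_nat j + 1)))"
    using summable_theta_coeff[OF q] by (simp add: norm_mult norm_power)
  from suminf_mult[OF summable_norm_cancel[OF this], of "qpow \<tau> (1 / 8)"]
  have "(\<Sum>n. qpow \<tau> (1 / 8) * ((-1) ^ n * q ^ tri n * (2 * of_nat n + 1))) = qpow \<tau> (1 /
      8) * euler_prod q ^ 3"
    unfolding * .
  with theta1_has_field_derivative_suminf[OF assms(1), of 0, folded q_def]
  have "((\<lambda>z. theta1 z \<tau>) has_field_derivative 2 * (qpow \<tau> (1 / 8) * euler_prod q ^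
      3)) (at 0)"
    by (simp only: mult_zero_right cos_zero mult_1_right)
  then show ?thesis
    by (simp add: DERIV_imp_deriv mult.assoc)
qed

lemma theta1_minus:
  assumes "Im \<tau> > 0"
  shows "theta1 (- z) \<tau> = - theta1 z \<tau>"
  using theta1_prod_tendsto[OF assms, of "- z"] tendsto_minus[OF theta1_prod_tendsto[OF assms, of z]]
  by (auto intro: LIMSEQ_unique)

lemma theta1_0 [simp]: "theta1 0 \<tau> = 0"
  by (simp add: theta1_def)

lemma theta1_plus_pi:
  assumes "Im \<tau> > 0"
  shows "theta1 (z + of_real pi) \<tau> = - theta1 z \<tau>"
proof -
  have "2 * (z + of_real pi) = 2 * z + of_real (2 * pi)"
    by simp
  then have "cos (2 * (z + of_real pi)) = cos (2 * z)"
    by (simp only: cos_add flip: cos_of_real sin_of_real) simp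
  moreover have "sin (z + of_real pi) = - sin z"
    by (simp add: sin_add flip: sin_of_real cos_of_real)
  ultimately show ?thesis
    using theta1_prod_tendsto[OF assms, of "z + of_real pi"] tendsto_minus[OF theta1_prod_tendsto[OF
        assms, of z]]
    by (auto intro: LIMSEQ_unique)
qed

section \<open>Quasi-period and zeros, from the product in w = exp (2 i z)\<close>

definition theta_prod :: "complex \<Rightarrow> nat \<Rightarrow> complex \<Rightarrow> complex" where
  "theta_prod q n w = (1 - w) * (\<Prod>k<n. (1 - q ^ Suc k * w) * (1 - q ^ Suc k / w))"

text \<open>Replacing w by q w shifts the two families of factors by one index in opposite
  directions, so everything telescopes except the ends. The boundary factors w - q^n and 1 - q^(n+1)
  w tend to w and 1.\<close>

lemma theta_prod_mult:
  assumes "w \<noteq> 0" "q \<noteq> 0"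
  shows "theta_prod q n (q * w) * (w - q ^ n) = - theta_prod q n w * (1 - q ^ Suc n * w)"
proof (induction n)
  case 0
  show ?case
    by (simp add: theta_prod_def algebra_simps)
next
  case (Suc n)
  have "theta_prod q (Suc n) (q * w) * (w - q ^ Suc n)
      = theta_prod q n (q * w) * ((1 - q ^ Suc n * (q * w)) * (1 - q ^ Suc n / (q * w))) * (w - q ^ Suc
          n)"
    by (simp add: theta_prod_def mult_ac)
  also have "1 - q ^ Suc n / (q * w) = (w - q ^ n) / w"
    using assms by (simp add: field_simps)
  also have "theta_prod q n (q * w) * ((1 - q ^ Suc n * (q * w)) * ((w - q ^ n) / w)) * (w - q ^ Suc n)
      = (theta_prod q n (q * w) * (w - q ^ n)) * (1 - q ^ Suc (Suc n) * w) * ((w - q ^ Suc n) / w)"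
    by (simp add: mult_ac)
  also have "(w - q ^ Suc n) / w = 1 - q ^ Suc n / w"
    using assms by (simp add: field_simps)
  finally show ?case
    unfolding Suc.IH by (simp add: theta_prod_def mult_ac)
qed

lemma theta1_eq_theta_prod_term:
  fixes z q :: complex
  defines "w \<equiv> exp (2 * \<i> * z)"
  shows "2 * sin z * (\<Prod>k<n. 1 - 2 * cos (2 * z) * q ^ Suc k + q ^ (2 * Suc k))
           = \<i> * exp (- (\<i> * z)) * theta_prod q n w"
proof -
  have w: "w \<noteq> 0"
    by (simp add: w_def)
  have e: "exp (\<i> * z) = exp (- (\<i> * z)) * w"
    by (simp add: w_def flip: exp_add)
  have "2 * sin z = \<i> * (exp (- (\<i> * z)) - exp (\<i> * z))"
    by (simp add: sin_exp_eq field_simps)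
  then have 1: "2 * sin z = \<i> * exp (- (\<i> * z)) * (1 - w)"
    unfolding e by (simp add: algebra_simps)
  have "2 * cos (2 * z) = w + 1 / w"
    by (simp add: cos_exp_eq w_def exp_minus field_simps)
  moreover have "1 - (w + 1 / w) * u + u * u = (1 - u * w) * (1 - u / w)" for u
    using w by (simp add: field_simps)
  moreover have "q ^ (2 * Suc k) = q ^ Suc k * q ^ Suc k" for k
    by (simp only: mult_2 power_add)
  ultimately have "1 - 2 * cos (2 * z) * q ^ Suc k + q ^ (2 * Suc k)
      = (1 - q ^ Suc k * w) * (1 - q ^ Suc k / w)" for k
    by (simp only:)
  then show ?thesis
    unfolding 1 theta_prod_def by simp
qed

lemma theta_prod_tendsto_theta1:
  assumes "Im \<tau> > 0"
  defines "q \<equiv> qpow \<tau> 1"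
  shows "(\<lambda>n. qpow \<tau> (1 / 8) * euler_prod q * \<i> * exp (- (\<i> * z)) * theta_prod q n
      (exp (2 * \<i> * z)))
           \<longlonglongrightarrow> theta1 z \<tau>"
proof -
  have "2 * qpow \<tau> (1 / 8) * euler_prod q * sin z * (\<Prod>k<n. 1 - 2 * cos (2 * z) * q ^ Suc k +
      q ^ (2 * Suc k))
      = qpow \<tau> (1 / 8) * euler_prod q * \<i> * exp (- (\<i> * z)) * theta_prod q n (exp (2 * \<i>
          * z))" for n
    using theta1_eq_theta_prod_term[of z q n] by (simp add: mult_ac)
  then show ?thesis
    using theta1_prod_tendsto[OF assms(1), of z] unfolding q_def by (simp only:)
qed

lemma theta1_plus_pi_tau:
  assumes "Im \<tau> > 0"
  shows "theta1 (z + of_real pi * \<tau>) \<tau> = - (exp (- (2 * \<i> * z)) * qpow \<tau> (- (1 / 2))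
      * theta1 z \<tau>)"
proof -
  define q where "q = qpow \<tau> 1"
  define w where "w = exp (2 * \<i> * z)"
  define c where "c = qpow \<tau> (1 / 8) * euler_prod q * \<i>"
  have q: "norm q < 1" "q \<noteq> 0"
    unfolding q_def using norm_qpow_1_less_1[OF assms] by simp_all
  have w: "w \<noteq> 0"
    by (simp add: w_def)
  have ew: "exp (2 * \<i> * (z + of_real pi * \<tau>)) = q * w"
    by (simp add: q_def w_def qpow_def exp_add[symmetric] algebra_simps)
  have ez: "exp (- (\<i> * (z + of_real pi * \<tau>))) = exp (- (\<i> * z)) * qpow \<tau> (- (1 / 2))"
    by (simp add: qpow_def exp_add[symmetric] algebra_simps)
  have q0: "(\<lambda>n. q ^ n) \<longlonglongrightarrow> 0" "(\<lambda>n. q ^ Suc n)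
      \<longlonglongrightarrow> 0"
    using q LIMSEQ_power_zero LIMSEQ_Suc by blast+
  have "(\<lambda>n. c * exp (- (\<i> * (z + of_real pi * \<tau>))) * theta_prod q n (q * w) * (w - q ^
      n))
      \<longlonglongrightarrow> theta1 (z + of_real pi * \<tau>) \<tau> * (w - 0)"
    using theta_prod_tendsto_theta1[OF assms, of "z + of_real pi * \<tau>"]
    unfolding ew q_def[symmetric] c_def by (intro tendsto_intros q0)
  moreover have "(\<lambda>n. - qpow \<tau> (- (1 / 2)) * (c * exp (- (\<i> * z)) * theta_prod q n w *
      (1 - q ^ Suc n * w)))
      \<longlonglongrightarrow> - qpow \<tau> (- (1 / 2)) * (theta1 z \<tau> * (1 - 0 * w))"
    using theta_prod_tendsto_theta1[OF assms, of z]
    unfolding w_def[symmetric] q_def[symmetric] c_def by (intro tendsto_intros q0)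
  moreover have "c * exp (- (\<i> * (z + of_real pi * \<tau>))) * theta_prod q n (q * w) * (w - q ^ n)
      = - qpow \<tau> (- (1 / 2)) * (c * exp (- (\<i> * z)) * theta_prod q n w * (1 - q ^ Suc n * w))"
          for n
  proof -
    have "c * exp (- (\<i> * (z + of_real pi * \<tau>))) * theta_prod q n (q * w) * (w - q ^ n)
        = c * (exp (- (\<i> * z)) * qpow \<tau> (- (1 / 2))) * (theta_prod q n (q * w) * (w - q ^ n))"
      unfolding ez by (simp only: mult.assoc)
    then show ?thesis
      unfolding theta_prod_mult[OF w q(2)] by simp
  qed
  ultimately have "theta1 (z + of_real pi * \<tau>) \<tau> * w = - qpow \<tau> (- (1 / 2)) * theta1 z
      \<tau>"
    by (simp add: LIMSEQ_unique)
  moreover have "exp (- (2 * \<i> * z)) = 1 / w"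
    by (simp add: w_def exp_minus inverse_eq_divide)
  moreover have "theta1 (z + of_real pi * \<tau>) \<tau> = theta1 (z + of_real pi * \<tau>) \<tau> * w
      * (1 / w)"
    using w by simp
  ultimately show ?thesis
    by simp
qed

definition period_lattice :: "complex \<Rightarrow> complex set" where
  "period_lattice \<tau> = {of_int m * of_real pi + of_int n * (of_real pi * \<tau>) | m n. True}"

text \<open>The two alternatives are the vanishing of a factor 1 - q^k w or 1 - q^k / w of the
  triple product at w = exp (2 i z).\<close>

lemma exp_eq_1_imp_lattice:
  assumes "exp (2 * \<i> * z) * qpow \<tau> 1 ^ k = 1 \<or> qpow \<tau> 1 ^ k / exp (2 * \<i> * z) = 1"
  shows "z \<in> period_lattice \<tau>"
proof -
  obtain j :: int where "exp (2 * \<i> * (z + of_int j * of_real pi * \<tau>)) = 1"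
  proof -
    have *: "qpow \<tau> 1 ^ k = exp (2 * \<i> * (of_nat k * of_real pi * \<tau>))"
      by (simp add: qpow_def mult_ac flip: exp_of_nat_mult)
    from assms show ?thesis
    proof
      assume "exp (2 * \<i> * z) * qpow \<tau> 1 ^ k = 1"
      then show ?thesis
        using that[of "int k"] unfolding * by (simp add: exp_add distrib_left)
    next
      assume "qpow \<tau> 1 ^ k / exp (2 * \<i> * z) = 1"
      then have "exp (2 * \<i> * z) * exp (- (2 * \<i> * (of_nat k * of_real pi * \<tau>))) = 1"
        unfolding * by (simp add: exp_minus field_simps)
      then show ?thesis
        using that[of "- int k"] by (simp add: exp_add[symmetric] algebra_simps)
    qed
  qed
  then obtain n :: int where n: "2 * \<i> * (z + of_int j * of_real pi * \<tau>) = of_int (2 * n) *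
      of_real pi * \<i>"
    unfolding exp_eq_1 by (auto simp: complex_eq_iff)
  then have "2 * \<i> * (z + of_int j * of_real pi * \<tau>) = 2 * \<i> * (of_int n * of_real pi)"
    by simp
  then have "z + of_int j * of_real pi * \<tau> = of_int n * of_real pi"
    by (subst (asm) mult_left_cancel) simp_all
  then have "z = of_int n * of_real pi + of_int (- j) * (of_real pi * \<tau>)"
    by (simp add: algebra_simps)
  then show ?thesis
    unfolding period_lattice_def by blast
qed

text \<open>A convergent infinite product can vanish only through one of its factors.\<close>

lemma theta1_eq_0_imp_lattice:
  assumes \<tau>: "Im \<tau> > 0" and "theta1 z \<tau> = 0"
  shows "z \<in> period_lattice \<tau>"
proof -
  define q where "q = qpow \<tau> 1"
  define w where "w = exp (2 * \<i> * z)"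
  have q: "norm q < 1"
    unfolding q_def by (rule norm_qpow_1_less_1[OF \<tau>])
  define P1 where "P1 = (\<Prod>k. 1 - q ^ Suc k * w)"
  define P2 where "P2 = (\<Prod>k. 1 - q ^ Suc k * (1 / w))"
  have c1: "convergent_prod (\<lambda>k. 1 - q ^ Suc k * w)" and c2: "convergent_prod (\<lambda>k. 1 -
      q ^ Suc k * (1 / w))"
    by (rule convergent_prod_one_minus_power[OF q])+
  have "(\<lambda>n. (1 - w) * ((\<Prod>k<n. 1 - q ^ Suc k * w) * (\<Prod>k<n. 1 - q ^ Suc k * (1 /
      w))))
      \<longlonglongrightarrow> (1 - w) * (P1 * P2)"
    unfolding P1_def P2_def
    by (intro tendsto_intros convergent_prod_tendsto_lessThan c1 c2)
  then have "(\<lambda>n. theta_prod q n w) \<longlonglongrightarrow> (1 - w) * (P1 * P2)"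
    by (simp add: theta_prod_def prod.distrib)
  then have "(\<lambda>n. qpow \<tau> (1 / 8) * euler_prod q * \<i> * exp (- (\<i> * z)) * theta_prod q
      n w)
      \<longlonglongrightarrow> qpow \<tau> (1 / 8) * euler_prod q * \<i> * exp (- (\<i> * z)) * ((1 -
          w) * (P1 * P2))"
    by (intro tendsto_intros)
  with theta_prod_tendsto_theta1[OF \<tau>, of z]
  have "theta1 z \<tau> = qpow \<tau> (1 / 8) * euler_prod q * \<i> * exp (- (\<i> * z)) * ((1 - w) *
      (P1 * P2))"
    unfolding q_def[symmetric] w_def[symmetric] by (rule LIMSEQ_unique)
  with assms(2) euler_prod_neq_0[OF q] consider "w = 1" | "P1 = 0" | "P2 = 0"
    by auto
  then have "\<exists>k. w * q ^ k = 1 \<or> q ^ k / w = 1"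
  proof cases
    case 1
    then show ?thesis
      by (intro exI[of _ 0]) simp
  next
    case 2
    then obtain k where "1 - q ^ Suc k * w = 0"
      using prodinf_nonzero[OF c1] unfolding P1_def by blast
    then show ?thesis
      by (metis eq_iff_diff_eq_0 mult.commute)
  next
    case 3
    then obtain k where "1 - q ^ Suc k * (1 / w) = 0"
      using prodinf_nonzero[OF c2] unfolding P2_def by blast
    then have "q ^ Suc k / w = 1"
      by simp
    then show ?thesis
      by blast
  qed
  then show ?thesis
    using exp_eq_1_imp_lattice unfolding q_def w_def by blast
qed

section \<open>Theta functions of higher degree\<close>

lemma shift_of_int_iff:
  fixes c :: complex
  assumes "\<And>z. P (z + c) \<longleftrightarrow> P z"
  shows "P (z + of_int m * c) \<longleftrightarrow> P z"
proof (induction m rule: int_induct[where k = 0])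
  case (step1 i)
  then show ?case
    using assms[of "z + of_int i * c"] by (simp add: algebra_simps)
next
  case (step2 i)
  then show ?case
    using assms[of "z + of_int (i - 1) * c"] by (simp add: algebra_simps)
qed simp

text \<open>Formulated for predicates so that it covers zeros, simplicity of zeros and values of
  doubly periodic functions alike.\<close>

lemma period_lattice_shift_iff:
  assumes "l \<in> period_lattice \<tau>"
    and "\<And>z. P (z + of_real pi) \<longleftrightarrow> P z" "\<And>z. P (z + of_real pi * \<tau>)
        \<longleftrightarrow> P z"
  shows "P (z + l) \<longleftrightarrow> P z"
proof -
  obtain m n where "l = of_int m * of_real pi + of_int n * (of_real pi * \<tau>)"
    using assms(1) by (auto simp: period_lattice_def)
  then have "z + l = (z + of_int m * of_real pi) + of_int n * (of_real pi * \<tau>)"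
    by simp
  then show ?thesis
    using shift_of_int_iff[of P, OF assms(2)] shift_of_int_iff[of P, OF assms(3)] by (simp only:)
qed

lemma period_lattice_diff:
  assumes "u \<in> period_lattice \<tau>" "v \<in> period_lattice \<tau>"
  shows "u - v \<in> period_lattice \<tau>"
proof -
  obtain m n m' n' where "u = of_int m * of_real pi + of_int n * (of_real pi * \<tau>)"
    "v = of_int m' * of_real pi + of_int n' * (of_real pi * \<tau>)"
    using assms by (auto simp: period_lattice_def)
  then have "u - v = of_int (m - m') * of_real pi + of_int (n - n') * (of_real pi * \<tau>)"
    by (simp add: algebra_simps)
  then show ?thesis
    unfolding period_lattice_def by blast
qed

text \<open>The model case is \<open>\<theta>(z + s\<^sub>1) \<dots> \<theta>(z + s\<^sub>n)\<close> with \<open>s = s\<^sub>1 + \<dots> + s\<^sub>n\<close>.\<close>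

definition theta_function :: "complex \<Rightarrow> nat \<Rightarrow> complex \<Rightarrow> (complex
    \<Rightarrow> complex) \<Rightarrow> bool" where
  "theta_function \<tau> n s F \<longleftrightarrow> F holomorphic_on UNIV \<and>
     (\<forall>z. F (z + of_real pi) = (-1) ^ n * F z) \<and>
     (\<forall>z. F (z + of_real pi * \<tau>)
        = (-1) ^ n * (exp (- (2 * \<i> * (of_nat n * z + s))) * qpow \<tau> (- real n / 2)) * F z)"

lemma theta_function_holomorphic: "theta_function \<tau> n s F \<Longrightarrow> F holomorphic_on UNIV"
  by (simp add: theta_function_def)

lemma theta_function_add:
  "theta_function \<tau> n s F \<Longrightarrow> theta_function \<tau> n s G \<Longrightarrow>
      theta_function \<tau> n s (\<lambda>z. F z + G z)"
  by (auto simp: theta_function_def algebra_simps intro!: holomorphic_intros)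

lemma theta_function_diff:
  "theta_function \<tau> n s F \<Longrightarrow> theta_function \<tau> n s G \<Longrightarrow>
      theta_function \<tau> n s (\<lambda>z. F z - G z)"
  by (auto simp: theta_function_def algebra_simps intro!: holomorphic_intros)

lemma theta_function_cmult:
  "theta_function \<tau> n s F \<Longrightarrow> theta_function \<tau> n s (\<lambda>z. c * F z)"
  by (auto simp: theta_function_def algebra_simps intro!: holomorphic_intros)

lemma theta_function_mult:
  assumes "theta_function \<tau> n s F" "theta_function \<tau> m t G"
  shows "theta_function \<tau> (n + m) (s + t) (\<lambda>z. F z * G z)"
proof -
  have 1: "exp (- (2 * \<i> * (of_nat (n + m) * z + (s + t))))
      = exp (- (2 * \<i> * (of_nat n * z + s))) * exp (- (2 * \<i> * (of_nat m * z + t)))" for z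
    by (simp add: exp_add[symmetric] algebra_simps)
  have 2: "qpow \<tau> (- real (n + m) / 2) = qpow \<tau> (- real n / 2) * qpow \<tau> (- real m / 2)"
    by (simp add: qpow_add[symmetric] add_divide_distrib diff_divide_distrib)
  show ?thesis
    using assms unfolding theta_function_def 1 2
    by (simp add: power_add holomorphic_on_mult)
qed

lemma theta_function_theta1:
  assumes "Im \<tau> > 0"
  shows "theta_function \<tau> 1 s (\<lambda>z. theta1 (z + s) \<tau>)"
proof -
  have "(\<lambda>z. theta1 (z + s) \<tau>) holomorphic_on UNIV"
    by (rule holomorphic_on_compose_gen[OF _ theta1_holomorphic[OF assms], unfolded o_def])
       (auto intro!: holomorphic_intros)
  moreover have "z + of_real pi + s = (z + s) + of_real pi"
    "z + of_real pi * \<tau> + s = (z + s) + of_real pi * \<tau>" for z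
    by simp_all
  ultimately show ?thesis
    unfolding theta_function_def by (auto simp only: theta1_plus_pi[OF assms] theta1_plus_pi_tau[OF
        assms]) simp_all
qed

lemma theta_function_power:
  assumes "theta_function \<tau> n s F" "k > 0"
  shows "theta_function \<tau> (k * n) (of_nat k * s) (\<lambda>z. F z ^ k)"
  using assms(2)
proof (induction k rule: nat_induct_non_zero)
  case (Suc k)
  from theta_function_mult[OF assms(1) Suc.IH] show ?case
    by (simp add: algebra_simps)
qed (use assms(1) in simp)

text \<open>The shift s enters only through exp (-2 i s), which has period \<pi>. This is what lets
  fifth powers at different multiples of \<pi>/5 be combined.\<close>

lemma theta_function_add_pi:
  "theta_function \<tau> n (s + of_real pi) F \<longleftrightarrow> theta_function \<tau> n s F"
proof -
  have "exp (- (2 * \<i> * (u + of_real pi))) = exp (- (2 * \<i> * u))" for u :: complex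
  proof -
    have "- (2 * \<i> * (u + of_real pi)) = - (2 * \<i> * u) - 2 * of_real pi * \<i>"
      by (simp add: algebra_simps)
    then show ?thesis
      by (simp only: exp_diff exp_two_pi_i) simp
  qed
  from this[of "of_nat n * z + s" for z] show ?thesis
    unfolding theta_function_def by (simp add: add.assoc)
qed

lemma theta_function_theta1_double:
  assumes "Im \<tau> > 0"
  shows "theta_function \<tau> 4 0 (\<lambda>z. theta1 (2 * z) \<tau>)"
  unfolding theta_function_def
proof (intro conjI allI)
  show "(\<lambda>z. theta1 (2 * z) \<tau>) holomorphic_on UNIV"
    by (rule holomorphic_on_compose_gen[OF _ theta1_holomorphic[OF assms], unfolded o_def])
       (auto intro!: holomorphic_intros)
  fix z :: complex
  have "2 * (z + of_real pi) = (2 * z + of_real pi) + of_real pi"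
    by simp
  then show "theta1 (2 * (z + of_real pi)) \<tau> = (-1) ^ 4 * theta1 (2 * z) \<tau>"
    by (simp only: theta1_plus_pi[OF assms]) simp
  have "exp (- (2 * \<i> * (2 * z + of_real pi * \<tau>))) * qpow \<tau> (- (1 / 2)) * (exp (- (2 *
      \<i> * (2 * z))) * qpow \<tau> (- (1 / 2)))
      = exp (- (2 * \<i> * (of_nat 4 * z + 0))) * qpow \<tau> (- real 4 / 2)"
    by (simp add: qpow_def exp_add[symmetric] algebra_simps)
  moreover have "2 * (z + of_real pi * \<tau>) = (2 * z + of_real pi * \<tau>) + of_real pi * \<tau>"
    by (simp add: algebra_simps)
  then have "theta1 (2 * (z + of_real pi * \<tau>)) \<tau>
      = exp (- (2 * \<i> * (2 * z + of_real pi * \<tau>))) * qpow \<tau> (- (1 / 2)) * (exp (- (2 *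
          \<i> * (2 * z))) * qpow \<tau> (- (1 / 2))) * theta1 (2 * z) \<tau>"
    by (simp only: theta1_plus_pi_tau[OF assms]) simp
  ultimately show "theta1 (2 * (z + of_real pi * \<tau>)) \<tau>
      = (-1) ^ 4 * (exp (- (2 * \<i> * (of_nat 4 * z + 0))) * qpow \<tau> (- real 4 / 2)) * theta1 (2 *
          z) \<tau>"
    by simp
qed

lemma theta_function_zero_shift:
  assumes "theta_function \<tau> n s F" "z - z0 \<in> period_lattice \<tau>" "F z0 = 0"
  shows "F z = 0"
  using period_lattice_shift_iff[OF assms(2), of "\<lambda>z. F z = 0" z0] assms(1,3)
  by (simp add: theta_function_def)

lemma theta1_eq_0_iff:
  assumes "Im \<tau> > 0"
  shows "theta1 z \<tau> = 0 \<longleftrightarrow> z \<in> period_lattice \<tau>"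
  using theta1_eq_0_imp_lattice[OF assms] theta_function_zero_shift[OF theta_function_theta1[OF assms,
      of 0], of z 0]
  by auto

text \<open>Congruence modulo the lattice is written as the vanishing of
  \<open>theta1 (z - z0) \<tau>\<close>, the form in which the zeros of theta products present
  themselves.\<close>

lemma theta_function_eq_0:
  assumes "Im \<tau> > 0" "theta_function \<tau> n s F" "theta1 (z - z0) \<tau> = 0" "F z0 = 0"
  shows "F z = 0"
  using theta_function_zero_shift[OF assms(2) _ assms(4)] assms(1,3) theta1_eq_0_iff by blast

lemma theta1_diff_eq_0:
  assumes "Im \<tau> > 0" "theta1 u \<tau> = 0" "theta1 v \<tau> = 0"
  shows "theta1 (u - v) \<tau> = 0"
  using assms theta1_eq_0_iff period_lattice_diff by blast

section \<open>Simple zeros, entire quotients and Liouville's theorem\<close>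

lemma holomorphic_UNIV_deriv: "F holomorphic_on UNIV \<Longrightarrow> (F has_field_derivative deriv F
    z) (at z)"
  using holomorphic_derivI by blast

text \<open>In the product rule the term with the derivative of m drops out at a zero of F. Hence
  simplicity of zeros, and the quotient of two derivatives at a common zero, are carried along by
  quasi-periods.\<close>

lemma deriv_shift_at_zero:
  assumes "F holomorphic_on UNIV" "m holomorphic_on UNIV" "\<And>z. F (z + c) = m z * F z" "F z = 0"
  shows "deriv F (z + c) = m z * deriv F z"
proof -
  have "((\<lambda>z. F (z + c)) has_field_derivative deriv F (z + c)) (at z)"
    using holomorphic_UNIV_deriv[OF assms(1), of "z + c"] by (simp add: DERIV_shift)
  moreover have "((\<lambda>z. m z * F z) has_field_derivative deriv m z * F z + deriv F z * m z) (at
      z)"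
    by (intro DERIV_mult holomorphic_UNIV_deriv assms)
  ultimately show ?thesis
    unfolding assms(3) using assms(4) DERIV_unique by fastforce
qed

definition simple_zeros :: "(complex \<Rightarrow> complex) \<Rightarrow> bool" where
  "simple_zeros G \<longleftrightarrow> (\<forall>z. G z = 0 \<longrightarrow> deriv G z \<noteq> 0)"

lemma simple_zeros_mult:
  assumes "F holomorphic_on UNIV" "G holomorphic_on UNIV" "simple_zeros F" "simple_zeros G"
    and "\<And>z. F z = 0 \<Longrightarrow> G z \<noteq> 0"
  shows "simple_zeros (\<lambda>z. F z * G z)"
  unfolding simple_zeros_def
proof (intro allI impI)
  fix z assume "F z * G z = 0"
  moreover have "deriv (\<lambda>z. F z * G z) z = deriv F z * G z + deriv G z * F z"
    by (intro DERIV_imp_deriv DERIV_mult holomorphic_UNIV_deriv assms)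
  ultimately show "deriv (\<lambda>z. F z * G z) z \<noteq> 0"
    using assms(3-5) by (auto simp: simple_zeros_def)
qed

text \<open>Every zero is a lattice translate of 0, where the derivative is known, and
  quasi-periodicity transports the nonvanishing.\<close>

lemma simple_zeros_theta1:
  assumes "Im \<tau> > 0"
  shows "simple_zeros (\<lambda>z. theta1 z \<tau>)"
  unfolding simple_zeros_def
proof (intro allI impI)
  fix z assume "theta1 z \<tau> = 0"
  let ?T = "\<lambda>z. theta1 z \<tau>"
  let ?P = "\<lambda>z. ?T z = 0 \<and> deriv ?T z \<noteq> 0"
  have P0: "?P 0"
    using deriv_theta1_0[OF assms] euler_prod_neq_0[OF norm_qpow_1_less_1[OF assms]] by simp
  have shift: "?P (z + c) \<longleftrightarrow> ?P z"
    if "m holomorphic_on UNIV" "\<And>z. ?T (z + c) = m z * ?T z" "\<And>z. m z \<noteq> 0" for m c z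
    using deriv_shift_at_zero[OF theta1_holomorphic[OF assms] that(1,2), of z] that(2,3) by auto
  have "?P (z + of_real pi) \<longleftrightarrow> ?P z" for z
    by (rule shift[of "\<lambda>_. - 1"]) (auto simp: theta1_plus_pi[OF assms])
  moreover have "?P (z + of_real pi * \<tau>) \<longleftrightarrow> ?P z" for z
    by (rule shift[of "\<lambda>z. - (exp (- (2 * \<i> * z)) * qpow \<tau> (- (1 / 2)))"])
       (auto simp: theta1_plus_pi_tau[OF assms] intro!: holomorphic_intros)
  ultimately show "deriv ?T z \<noteq> 0"
    using period_lattice_shift_iff[of z \<tau> ?P 0] P0 theta1_eq_0_iff[OF assms] \<open>theta1 z
        \<tau> = 0\<close> by auto
qed

lemma simple_zeros_compose_affine:
  assumes "F holomorphic_on UNIV" "simple_zeros F" "a \<noteq> 0"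
  shows "simple_zeros (\<lambda>z. F (a * z + b))"
  unfolding simple_zeros_def
proof (intro allI impI)
  fix z assume "F (a * z + b) = 0"
  have "((\<lambda>z. F (a * z + b)) has_field_derivative deriv F (a * z + b) * a) (at z)"
    by (rule DERIV_chain2[OF holomorphic_UNIV_deriv[OF assms(1)]]) (auto intro!: derivative_eq_intros)
  then show "deriv (\<lambda>z. F (a * z + b)) z \<noteq> 0"
    using assms(2,3) \<open>F (a * z + b) = 0\<close> by (simp add: simple_zeros_def DERIV_imp_deriv)
qed

text \<open>At a zero of G the function is given its removable value by l'Hopital's rule: near such
  a point z0 it equals the quotient of the entire difference quotients \<open>F1\<close> and
  \<open>G1\<close>, and \<open>G1 z0\<close> is not 0.\<close>

lemma holomorphic_quotient_simple_zeros:
  assumes F: "F holomorphic_on UNIV" and G: "G holomorphic_on UNIV"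
    and "simple_zeros G" "\<And>z. G z = 0 \<Longrightarrow> F z = 0"
  shows "(\<lambda>z. if G z = 0 then deriv F z / deriv G z else F z / G z) holomorphic_on UNIV"
    (is "?H holomorphic_on UNIV")
proof -
  have "\<exists>U. open U \<and> z0 \<in> U \<and> ?H holomorphic_on U" for z0
  proof (cases "G z0 = 0")
    case False
    define U where "U = {z. G z \<noteq> 0}"
    have "open U"
      unfolding U_def by (intro open_Collect_neq continuous_intros holomorphic_on_imp_continuous_on G)
    moreover have "(\<lambda>z. F z / G z) holomorphic_on U"
      by (intro holomorphic_intros holomorphic_on_subset[OF F] holomorphic_on_subset[OF G]) (auto simp:
          U_def)
    then have "?H holomorphic_on U"
      by (rule holomorphic_transform) (auto simp: U_def)
    ultimately show ?thesis
      using False by (auto simp: U_def)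
  next
    case True
    define F1 where "F1 = (\<lambda>z. if z = z0 then deriv F z0 else (F z - F z0) / (z - z0))"
    define G1 where "G1 = (\<lambda>z. if z = z0 then deriv G z0 else (G z - G z0) / (z - z0))"
    have F1: "F1 holomorphic_on UNIV" and G1: "G1 holomorphic_on UNIV"
      unfolding F1_def G1_def by (intro pole_lemma_open F G open_UNIV)+
    have FG: "F z0 = 0" "deriv G z0 \<noteq> 0"
      using True assms by (auto simp: simple_zeros_def)
    define U where "U = {z. G1 z \<noteq> 0}"
    have "open U"
      unfolding U_def by (intro open_Collect_neq continuous_intros holomorphic_on_imp_continuous_on G1)
    moreover have "z0 \<in> U"
      using FG by (simp add: U_def G1_def)
    moreover have "(\<lambda>z. F1 z / G1 z) holomorphic_on U"
      by (intro holomorphic_intros holomorphic_on_subset[OF F1] holomorphic_on_subset[OF G1]) (auto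
          simp: U_def)
    then have "?H holomorphic_on U"
      by (rule holomorphic_transform) (use True FG in \<open>auto simp: U_def F1_def G1_def\<close>)
    ultimately show ?thesis
      by blast
  qed
  then show ?thesis
    by (meson analytic_imp_holomorphic analytic_on_def analytic_on_open holomorphic_on_imp_analytic_at
        analytic_on_analytic_at)
qed

lemma doubly_periodic_entire_constant:
  assumes \<tau>: "Im \<tau> > 0" and hol: "H holomorphic_on UNIV"
    and p1: "\<And>z. H (z + of_real pi) = H z" and p2: "\<And>z. H (z + of_real pi * \<tau>) = H z"
  obtains c where "\<And>z. H z = c"
proof -
  define K where "K = (\<lambda>(s, t). of_real s * of_real pi + of_real t * (of_real pi * \<tau>)) `
      ({0..1::real} \<times> {0..1::real})"
  have "compact K"
    unfolding K_def by (intro compact_continuous_image compact_Times)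
      (auto simp: case_prod_beta intro!: continuous_intros)
  then have "bounded (H ` K)"
    by (intro compact_imp_bounded compact_continuous_image holomorphic_on_imp_continuous_on
        holomorphic_on_subset[OF hol]) auto
  moreover have "H z \<in> H ` K" for z
  proof -
    define t where "t = Im z / (pi * Im \<tau>)"
    define s where "s = (Re z - t * pi * Re \<tau>) / pi"
    have z: "z = of_real s * of_real pi + of_real t * (of_real pi * \<tau>)"
      using \<tau> by (simp add: complex_eq_iff s_def t_def)
    define w where "w = of_real (frac s) * of_real pi + of_real (frac t) * (of_real pi * \<tau>)"
    have "w \<in> K"
      unfolding K_def w_def by (auto simp: frac_lt_1 less_imp_le intro!: image_eqI[of _ _ "(frac s,
          frac t)"])
    have "z = w + (of_int \<lfloor>s\<rfloor> * of_real pi + of_int \<lfloor>t\<rfloor> * (of_real pi *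
        \<tau>))"
      unfolding z w_def frac_def by (simp add: algebra_simps)
    moreover have "of_int \<lfloor>s\<rfloor> * of_real pi + of_int \<lfloor>t\<rfloor> * (of_real pi *
        \<tau>) \<in> period_lattice \<tau>"
      unfolding period_lattice_def by blast
    ultimately have "H z = H w"
      using period_lattice_shift_iff[of _ \<tau> "\<lambda>u. H u = H w" w] p1 p2 by simp
    with \<open>w \<in> K\<close> show ?thesis
      by simp
  qed
  ultimately have "bounded (range H)"
    by (meson bounded_subset image_subsetI)
  then have "H constant_on UNIV"
    by (rule Liouville_theorem[OF hol])
  then show ?thesis
    using that by (auto simp: constant_on_def)
qed

text \<open>Equal multipliers cancel in the quotient, which is entire by simplicity and hence
  constant. The theta identities that follow come from checking zeros for this lemma and then
  evaluating at one point to find c.\<close>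

lemma theta_function_proportional:
  assumes \<tau>: "Im \<tau> > 0" and F: "theta_function \<tau> n s F" and G: "theta_function \<tau> n
      s G"
    and "simple_zeros G" "\<And>z. G z = 0 \<Longrightarrow> F z = 0"
  obtains c where "\<And>z. F z = c * G z"
proof -
  define H where "H = (\<lambda>z. if G z = 0 then deriv F z / deriv G z else F z / G z)"
  have hol: "F holomorphic_on UNIV" "G holomorphic_on UNIV"
    using F G by (auto simp: theta_function_def)
  have H: "H holomorphic_on UNIV"
    unfolding H_def by (intro holomorphic_quotient_simple_zeros hol assms)
  have shift: "H (z + c) = H z"
    if m: "m holomorphic_on UNIV" "\<And>z. m z \<noteq> 0"
      and mF: "\<And>z. F (z + c) = m z * F z" and mG: "\<And>z. G (z + c) = m z * G z" for m c z
    using deriv_shift_at_zero[OF hol(1) m(1) mF, of z] deriv_shift_at_zero[OF hol(2) m(1) mG, of z]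
      m(2)[of z] mF[of z] mG[of z] assms(5)[of z] by (simp add: H_def)
  have "H (z + of_real pi) = H z" for z
    using F G by (intro shift[of "\<lambda>_. (-1) ^ n"]) (auto simp: theta_function_def)
  moreover have "H (z + of_real pi * \<tau>) = H z" for z
    using F G by (intro shift[of "\<lambda>z. (-1) ^ n * (exp (- (2 * \<i> * (of_nat n * z + s))) *
        qpow \<tau> (- real n / 2))"])
      (auto simp: theta_function_def intro!: holomorphic_intros)
  ultimately obtain c where c: "\<And>z. H z = c"
    using doubly_periodic_entire_constant[OF \<tau> H] by metis
  have "F z = c * G z" for z
    using assms(5)[of z] c[of z] by (auto simp: H_def split: if_splits)
  then show ?thesis
    using that by blast
qed

lemma theta_function_add_of_int_pi:
  "theta_function \<tau> n (s + of_int m * of_real pi) F \<longleftrightarrow> theta_function \<tau> n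
      s F"
  by (rule shift_of_int_iff[of "\<lambda>s. theta_function \<tau> n s F"]) (rule theta_function_add_pi)

lemma eq_uminus_imp_0:
  fixes x :: complex
  assumes "x = - x"
  shows "x = 0"
  using assms by (simp add: eq_neg_iff_add_eq_0 flip: mult_2)

text \<open>At a half-period z0, the period 2 z0 carries -z0 back to z0. For even n and s = 0 the
  multiplier of this shift is 1, so oddness gives F z0 = - F z0.\<close>

lemma odd_theta_function_half_period:
  assumes \<tau>: "Im \<tau> > 0" and F: "theta_function \<tau> n 0 F" and "even n"
    and odd: "\<And>z. F (- z) = - F z" and "theta1 (2 * z) \<tau> = 0"
  shows "F z = 0"
proof -
  obtain k l where kl: "2 * z = of_int k * of_real pi + of_int l * (of_real pi * \<tau>)"
    using assms theta1_eq_0_iff by (auto simp: period_lattice_def)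
  \<comment> \<open>Reducing the coordinates of 2z modulo 2 replaces z by one of the four
    half-periods representing all cases.\<close>
  define z0 where "z0 = (of_int (k mod 2) * of_real pi + of_int (l mod 2) * (of_real pi * \<tau>)) / 2"
  have "of_int j = 2 * of_int (j div 2) + (of_int (j mod 2) :: complex)" for j
    by (metis mult_div_mod_eq of_int_add of_int_mult of_int_numeral)
  from kl[unfolded this[of k] this[of l]]
  have "2 * z = (2 * of_int (k div 2) + of_int (k mod 2)) * of_real pi
      + (2 * of_int (l div 2) + of_int (l mod 2)) * (of_real pi * \<tau>)" .
  then have "z - z0 = of_int (k div 2) * of_real pi + of_int (l div 2) * (of_real pi * \<tau>)"
    unfolding z0_def by (simp add: field_simps)
  then have *: "z - z0 \<in> period_lattice \<tau>"
    unfolding period_lattice_def by blast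
  have F1: "F (u + of_real pi) = F u" for u
    using F \<open>even n\<close> by (simp add: theta_function_def)
  have F2: "F (of_real pi * \<tau> - u) = - F u" if "exp (2 * \<i> * of_nat n * u) * qpow \<tau> (-
      real n / 2) = 1" for u
  proof -
    have "F (- u + of_real pi * \<tau>) = exp (2 * \<i> * of_nat n * u) * qpow \<tau> (- real n / 2) *
        F (- u)"
      using F[unfolded theta_function_def, THEN conjunct2, THEN conjunct2, rule_format, of "- u"]
          \<open>even n\<close>
      by (simp add: mult_ac)
    then show ?thesis
      using that by (simp add: odd)
  qed
  obtain n' where n': "n = 2 * n'"
    using \<open>even n\<close> by blast
  have E: "exp (2 * \<i> * of_nat n * (of_int e * of_real pi / 2 + of_real pi * \<tau> / 2)) * qpow
      \<tau> (- real n / 2) = 1" for e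
  proof -
    have "exp (2 * \<i> * of_nat n * (of_int e * of_real pi / 2 + of_real pi * \<tau> / 2)) * qpow
        \<tau> (- real n / 2)
        = exp (of_int (2 * (int n' * e)) * (of_real pi * \<i>))"
      by (simp add: qpow_def exp_add[symmetric] n' algebra_simps)
    also have "\<dots> = 1"
      by (auto simp: exp_eq_1 intro!: exI[of _ "int n' * e"])
    finally show ?thesis .
  qed
  have "k mod 2 = 0 \<or> k mod 2 = 1" "l mod 2 = 0 \<or> l mod 2 = 1"
    by auto
  then consider "z0 = 0" | "z0 = of_real pi / 2" | "z0 = of_real pi * \<tau> / 2"
    | "z0 = of_real pi / 2 + of_real pi * \<tau> / 2"
    unfolding z0_def by (auto simp: add_divide_distrib)
  then have "F z0 = 0"
  proof cases
    case 1
    then show ?thesis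
      using odd[of 0] by (auto intro: eq_uminus_imp_0)
  next
    case 2
    then have "- z0 + of_real pi = z0"
      by (simp add: field_simps)
    then show ?thesis
      using odd[of z0] F1[of "- z0"] by (intro eq_uminus_imp_0) (simp only:)
  next
    case 3
    then have "of_real pi * \<tau> - z0 = z0"
      by (simp add: field_simps)
    moreover have "exp (2 * \<i> * of_nat n * z0) * qpow \<tau> (- real n / 2) = 1"
      using E[of 0] unfolding 3 by simp
    ultimately show ?thesis
      using F2[of z0] by (intro eq_uminus_imp_0) (simp only:)
  next
    case 4
    then have "of_real pi * \<tau> - z0 + of_real pi = z0"
      by (simp add: field_simps)
    moreover have "exp (2 * \<i> * of_nat n * z0) * qpow \<tau> (- real n / 2) = 1"
      using E[of 1] unfolding 4 by simp
    ultimately show ?thesis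
      using F1[of "of_real pi * \<tau> - z0"] F2[of z0] by (intro eq_uminus_imp_0) (simp only:)
  qed
  then show ?thesis
    using theta_function_zero_shift[OF F *] by simp
qed

text \<open>Divided differences of the three equations yield Vieta's formulas because the roots are
  distinct; the rest is a polynomial identity.\<close>

lemma discriminant_cubic:
  fixes a b c d u v w :: complex
  assumes "a * u ^ 3 + b * u ^ 2 + c * u + d = 0" "a * v ^ 3 + b * v ^ 2 + c * v + d = 0"
    "a * w ^ 3 + b * w ^ 2 + c * w + d = 0" and ne: "u \<noteq> v" "u \<noteq> w" "v \<noteq> w"
  shows "b\<^sup>2 * c\<^sup>2 - 4 * a * c ^ 3 - 4 * b ^ 3 * d - 27 * a\<^sup>2 * d\<^sup>2 + 18 * a *
      b * c * d
           = a ^ 4 * ((u - v) * (u - w) * (v - w))\<^sup>2"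
proof -
  have "(u - v) * (a * (u\<^sup>2 + u * v + v\<^sup>2) + b * (u + v) + c) = 0"
    using assms(1,2) by algebra
  then have 1: "a * (u\<^sup>2 + u * v + v\<^sup>2) + b * (u + v) + c = 0"
    using ne by simp
  have "(u - w) * (a * (u\<^sup>2 + u * w + w\<^sup>2) + b * (u + w) + c) = 0"
    using assms(1,3) by algebra
  then have 2: "a * (u\<^sup>2 + u * w + w\<^sup>2) + b * (u + w) + c = 0"
    using ne by simp
  have "(v - w) * (a * (u + v + w) + b) = 0"
    using 1 2 by algebra
  then have "a * (u + v + w) + b = 0"
    using ne by simp
  then have b: "b = - a * (u + v + w)"
    by algebra
  have c: "c = a * (u * v + u * w + v * w)"
    using 1 unfolding b by algebra
  have d: "d = - a * (u * v * w)"
    using assms(1) unfolding b c by algebra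
  show ?thesis
    unfolding b c d by algebra
qed

text \<open>For \<alpha> = 2\<pi>/5 the equality cos (3\<alpha>) = cos (2\<alpha>), with the root 1
  removed, gives 4 c^2 + 2 c - 1 = 0.\<close>

lemma cos_two_fifths_pi:
  fixes c d :: real
  defines "c \<equiv> cos (2 * pi / 5)" and "d \<equiv> cos (4 * pi / 5)"
  shows "c + d = - 1 / 2" "c * d = - 1 / 4"
proof -
  have d: "d = 2 * c\<^sup>2 - 1"
    using cos_double_cos[of "2 * pi / 5"] by (simp add: c_def d_def)
  have "cos (2 * pi - 4 * pi / 5) = cos (4 * pi / 5)"
    by (rule cos_2pi_minus)
  moreover have "2 * pi - 4 * pi / 5 = 3 * (2 * pi / 5)"
    by simp
  ultimately have "4 * c ^ 3 - 3 * c = d"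
    using cos_treble_cos[of "2 * pi / 5"] by (simp add: c_def d_def)
  then have "(c - 1) * (4 * c\<^sup>2 + 2 * c - 1) = 0"
    unfolding d by algebra
  moreover have "c < 1"
    using cos_monotone_0_pi[of 0 "2 * pi / 5"] by (simp add: c_def)
  ultimately have *: "4 * c\<^sup>2 + 2 * c - 1 = 0"
    by simp
  then show "c + d = - 1 / 2"
    by (simp add: d)
  show "c * d = - 1 / 4"
    using * unfolding d by algebra
qed

lemma dedekind_eta_eq: "dedekind_eta \<tau> = qpow \<tau> (1 / 24) * euler_prod (qpow \<tau> 1)"
  unfolding dedekind_eta_def euler_prod_def qpow_nat ..

lemma dedekind_eta_neq_0: "Im \<tau> > 0 \<Longrightarrow> dedekind_eta \<tau> \<noteq> 0"
  by (simp add: dedekind_eta_eq euler_prod_neq_0 norm_qpow_1_less_1)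

section \<open>Special values\<close>

text \<open>Finite form of Euler's theorem on distinct and odd parts: in the limit the products of 1
  + q^k and of 1 - q^(2k-1) are inverse to each other.\<close>

lemma qfact_double:
  "(\<Prod>k<n. 1 + q ^ Suc k) * (\<Prod>k<n. 1 - q ^ (2 * k + 1)) * qfact q n = qfact q (2 * n)"
proof (induction n)
  case (Suc n)
  have "qfact q (2 * Suc n) = qfact q (2 * n) * (1 - q ^ (2 * n + 1)) * (1 - q ^ (2 * n + 2))"
    by (simp add: qfact_Suc)
  also have "1 - q ^ (2 * n + 2) = (1 + q ^ Suc n) * (1 - q ^ Suc n)"
  proof -
    have "q ^ (2 * n + 2) = q ^ Suc n * q ^ Suc n"
      by (simp add: mult_2 flip: power_add)
    then show ?thesis
      by (simp only:) (simp only: ring_distribs, simp)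
  qed
  finally show ?case
    unfolding Suc.IH[symmetric] by (simp only: prod.lessThan_Suc qfact_Suc mult_ac)
qed (simp add: qfact_def)

text \<open>The factors 1 - q^(2k+3) are the odd factors shifted by one index; 1 - q supplies the
  missing first one, and one surplus factor remains at the end.\<close>

lemma prod_odd_powers:
  fixes q :: complex
  shows "(1 - q) * (\<Prod>k<n. (1 - q ^ (2 * k + 3)) * (1 - q ^ (2 * k + 1)))
           = (\<Prod>k<n. 1 - q ^ (2 * k + 1))\<^sup>2 * (1 - q ^ (2 * n + 1))"
proof (induction n)
  case (Suc n)
  have "(1 - q) * (\<Prod>k<Suc n. (1 - q ^ (2 * k + 3)) * (1 - q ^ (2 * k + 1)))
      = ((1 - q) * (\<Prod>k<n. (1 - q ^ (2 * k + 3)) * (1 - q ^ (2 * k + 1))))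
          * ((1 - q ^ (2 * n + 3)) * (1 - q ^ (2 * n + 1)))"
    by (simp only: prod.lessThan_Suc mult_ac)
  also have "2 * n + 3 = 2 * Suc n + 1"
    by simp
  finally show ?case
    unfolding Suc.IH by (simp only: prod.lessThan_Suc power2_eq_square mult_ac)
qed simp

text \<open>With X = q^(k+1), the two quadratics multiply to 1 + X + X^2 + X^3 + X^4 = (1 - X^5) /
  (1 - X). This is how q^5, and with it the eta function at 5\<tau>, appears.\<close>

lemma prod_quintic_factors:
  fixes q :: complex and c d :: real
  assumes "norm q < 1" "c + d = - 1 / 2" "c * d = - 1 / 4"
  shows "(\<Prod>k<n. 1 - 2 * of_real c * q ^ Suc k + q ^ (2 * Suc k))
       * (\<Prod>k<n. 1 - 2 * of_real d * q ^ Suc k + q ^ (2 * Suc k)) = qfact (q ^ 5) n / qfact q n"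
proof -
  have "(1 - 2 * of_real c * q ^ Suc k + q ^ (2 * Suc k)) * (1 - 2 * of_real d * q ^ Suc k + q ^ (2 *
      Suc k))
      = (1 - (q ^ 5) ^ Suc k) / (1 - q ^ Suc k)" for k
  proof -
    define X where "X = q ^ Suc k"
    have X: "q ^ (2 * Suc k) = X\<^sup>2" "(q ^ 5) ^ Suc k = X ^ 5"
      unfolding X_def by (simp_all only: mult.commute flip: power_mult)
    have cd: "of_real c + of_real d = (- 1 / 2 :: complex)" "of_real c * of_real d = (- 1 / 4 ::
        complex)"
      using assms(2,3) by (metis of_real_add of_real_minus of_real_1 of_real_divide of_real_numeral,
          metis of_real_mult of_real_minus of_real_1 of_real_divide of_real_numeral)
    have "(1 - 2 * of_real c * X + X\<^sup>2) * (1 - 2 * of_real d * X + X\<^sup>2)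
        = 1 - 2 * (of_real c + of_real d) * X + 2 * X\<^sup>2 + 4 * (of_real c * of_real d) * X\<^sup>2
          - 2 * (of_real c + of_real d) * X ^ 3 + X ^ 4"
      by (simp add: algebra_simps power2_eq_square power3_eq_cube power4_eq_xxxx)
    also have "\<dots> = 1 + X + X\<^sup>2 + X ^ 3 + X ^ 4"
      unfolding cd by simp
    finally have "(1 - 2 * of_real c * X + X\<^sup>2) * (1 - 2 * of_real d * X + X\<^sup>2) * (1 - X)
        = (1 + X + X\<^sup>2 + X ^ 3 + X ^ 4) * (1 - X)"
      by (simp only:)
    also have "\<dots> = 1 - X ^ 5"
      by (simp add: algebra_simps eval_nat_numeral)
    finally have "(1 - 2 * of_real c * X + X\<^sup>2) * (1 - 2 * of_real d * X + X\<^sup>2) * (1 - X) =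
        1 - X ^ 5" .
    then show ?thesis
      unfolding X X_def[symmetric] using one_minus_power_neq_0[OF assms(1), of k]
      by (simp add: X_def eq_divide_eq)
  qed
  then show ?thesis
    unfolding qfact_def prod.distrib[symmetric] prod_dividef[symmetric] by (simp only:)
qed

locale upper_half_plane =
  fixes \<tau> :: complex
  assumes im_pos: "Im \<tau> > 0"
begin

abbreviation \<theta> :: "complex \<Rightarrow> complex" where
  "\<theta> z \<equiv> theta1 z \<tau>"

definition q :: complex where
  "q = qpow \<tau> 1"

lemma q: "norm q < 1" "q \<noteq> 0"
  using norm_qpow_1_less_1[OF im_pos] by (simp_all add: q_def)

lemmas theta1_minus' = theta1_minus[OF im_pos]
  and theta1_tendsto = theta1_prod_tendsto[OF im_pos, folded q_def]

lemma theta1_minus_pi: "\<theta> (of_real pi - z) = \<theta> z"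
  using theta1_plus_pi[OF im_pos, of "- z"] by (simp add: theta1_minus')

lemma theta1_double_eq_0: "\<theta> z = 0 \<Longrightarrow> \<theta> (2 * z) = 0"
  using theta1_diff_eq_0[OF im_pos, of z "- z"] by (simp add: theta1_minus')

text \<open>The value is 2 i q^(-1/4) \<eta>^3. The factors at \<pi>/2 are (1 + q^k)^2, those at the
  other two half-periods combine to odd powers of q, and Euler's theorem cancels them against each
  other.\<close>

lemma prod_theta1_half_periods:
  "\<theta> (of_real pi / 2) * \<theta> (of_real pi * \<tau> / 2) * \<theta> (of_real pi / 2 + of_real
      pi * \<tau> / 2)
     = 2 * \<i> * qpow \<tau> (- (1 / 8)) * euler_prod q ^ 3"
proof -
  define E where "E = euler_prod q"
  define C where "C = cos (of_real pi * \<tau>)"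
  let ?k = "2 * qpow \<tau> (1 / 8) * E"
  define s where "s = sin (of_real pi * \<tau> / 2)"
  define t where "t = cos (of_real pi * \<tau> / 2)"
  have E: "E \<noteq> 0"
    unfolding E_def by (rule euler_prod_neq_0[OF q(1)])
  \<comment> \<open>Multiplying the factors at \<pi>\<tau>/2 and \<pi>/2 + \<pi>\<tau>/2 leaves only
    C^2, so half-integral powers of q disappear from the infinite product.\<close>
  have C2: "4 * C\<^sup>2 = q + 2 + 1 / q"
  proof -
    have h: "q = exp (\<i> * (of_real pi * \<tau>)) * exp (\<i> * (of_real pi * \<tau>))"
      by (simp add: q_def qpow_def exp_add[symmetric] algebra_simps)
    show ?thesis
      unfolding C_def cos_exp_eq h exp_minus by (simp add: field_simps power2_eq_square)
  qed
  have st: "4 * (s * t) = \<i> * qpow \<tau> (- (1 / 2)) * (1 - q)"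
  proof -
    have "2 * (s * t) = sin (of_real pi * \<tau>)"
      using sin_double[of "of_real pi * \<tau> / 2"] by (simp add: s_def t_def)
    moreover have "2 * sin (of_real pi * \<tau>) = \<i> * (exp (- (\<i> * (of_real pi * \<tau>))) - exp
        (\<i> * (of_real pi * \<tau>)))"
      by (simp add: sin_exp_eq field_simps)
    moreover have "exp (- (\<i> * (of_real pi * \<tau>))) = qpow \<tau> (- (1 / 2))"
      by (simp add: qpow_def algebra_simps)
    moreover have "exp (\<i> * (of_real pi * \<tau>)) = qpow \<tau> (- (1 / 2)) * q"
      by (simp add: qpow_def q_def exp_add[symmetric] algebra_simps)
    moreover have "4 * (s * t) = 2 * (2 * (s * t))"
      by simp
    ultimately show ?thesis
      by (simp only:) (simp add: algebra_simps)
  qed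
  define X where "X k = q ^ Suc k" for k
  have X2: "q ^ (2 * Suc k) = X k * X k" for k
    unfolding X_def by (simp only: mult_2 power_add)
  have lim1: "(\<lambda>n. ?k * (\<Prod>k<n. 1 + q ^ Suc k)\<^sup>2) \<longlonglongrightarrow> \<theta>
      (of_real pi / 2)"
  proof -
    have "(1 - 2 * cos (2 * (of_real pi / 2)) * q ^ Suc k + q ^ (2 * Suc k)) = (1 + q ^ Suc k)\<^sup>2"
        for k
      unfolding X2 X_def[symmetric] by (simp add: power2_eq_square algebra_simps flip: cos_of_real)
    moreover have "sin (of_real pi / 2) = (1 :: complex)"
      using sin_of_real[of "pi / 2", where 'a = complex] by simp
    ultimately show ?thesis
      using theta1_tendsto[of "of_real pi / 2"] by (simp only: prod_power_distrib E_def) simp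
  qed
  have lim2: "(\<lambda>n. ?k * s * (\<Prod>k<n. 1 - 2 * C * X k + X k * X k))
      \<longlonglongrightarrow> \<theta> (of_real pi * \<tau> / 2)"
    using theta1_tendsto[of "of_real pi * \<tau> / 2"] unfolding E_def C_def s_def X2 X_def[symmetric]
        by simp
  have lim3: "(\<lambda>n. ?k * t * (\<Prod>k<n. 1 + 2 * C * X k + X k * X k))
      \<longlonglongrightarrow> \<theta> (of_real pi / 2 + of_real pi * \<tau> / 2)"
  proof -
    have "2 * (of_real pi / 2 + of_real pi * \<tau> / 2) = of_real pi + of_real pi * \<tau>"
      by (simp add: field_simps)
    then have "cos (2 * (of_real pi / 2 + of_real pi * \<tau> / 2)) = - C"
      by (simp add: C_def cos_add flip: sin_of_real cos_of_real)
    moreover have "sin (of_real pi / 2 + of_real pi * \<tau> / 2) = t"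
    proof -
      have "sin (of_real pi / 2) = (1 :: complex)" "cos (of_real pi / 2) = (0 :: complex)"
        using sin_of_real[of "pi / 2", where 'a = complex] cos_of_real[of "pi / 2", where 'a = complex]
            by simp_all
      then show ?thesis
        unfolding t_def sin_add by simp
    qed
    ultimately show ?thesis
      using theta1_tendsto[of "of_real pi / 2 + of_real pi * \<tau> / 2"] unfolding E_def X2
          X_def[symmetric] by simp
  qed
  have partial: "(?k * (\<Prod>k<n. 1 + q ^ Suc k)\<^sup>2) * (?k * s * (\<Prod>k<n. 1 - 2 * C * X k +
      X k * X k))
        * (?k * t * (\<Prod>k<n. 1 + 2 * C * X k + X k * X k))
      = 2 * \<i> * qpow \<tau> (- (1 / 8)) * E ^ 3 * ((qfact q (2 * n) / qfact q n)\<^sup>2 * (1 - q ^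
          (2 * n + 1)))" for n
  proof -
    define R where "R = (\<Prod>k<n. 1 + q ^ Suc k)"
    define Q where "Q = (\<Prod>k<n. 1 - q ^ (2 * k + 1))"
    have fac: "(1 - 2 * C * X k + X k * X k) * (1 + 2 * C * X k + X k * X k) = (1 - q ^ (2 * k + 3)) *
        (1 - q ^ (2 * k + 1))" for k
    proof -
      have "q ^ (2 * k + 3) = q * (X k * X k)"
        unfolding X2[symmetric] by (simp add: eval_nat_numeral)
      moreover have "q ^ (2 * k + 1) = 1 / q * (X k * X k)"
        unfolding X2[symmetric] using q(2) by simp
      moreover have "(1 - 2 * C * X k + X k * X k) * (1 + 2 * C * X k + X k * X k)
          = 1 + 2 * (X k * X k) + (X k * X k) * (X k * X k) - 4 * C\<^sup>2 * (X k * X k)"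
        by (simp add: power2_eq_square algebra_simps)
      moreover have "1 + 2 * y + y * y - (q + 2 + 1 / q) * y = (1 - q * y) * (1 - 1 / q * y)" for y
        using q(2) by (simp add: field_simps)
      ultimately show ?thesis
        unfolding C2 by (simp only:)
    qed
    have RQ: "R * Q = qfact q (2 * n) / qfact q n"
      using qfact_double[of q n] qfact_neq_0[OF q(1), of n] by (simp add: R_def Q_def field_simps)
    have k3: "qpow \<tau> (1 / 8) ^ 3 * qpow \<tau> (- (1 / 2)) = qpow \<tau> (- (1 / 8))"
      unfolding qpow_power qpow_add[symmetric] by simp
    have "(?k * R\<^sup>2) * (?k * s * (\<Prod>k<n. 1 - 2 * C * X k + X k * X k))
        * (?k * t * (\<Prod>k<n. 1 + 2 * C * X k + X k * X k))
        = 2 * qpow \<tau> (1 / 8) ^ 3 * E ^ 3 * R\<^sup>2 * (4 * (s * t)) * (\<Prod>k<n. (1 - 2 * C * X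
            k + X k * X k) * (1 + 2 * C * X k + X k * X k))"
      by (simp add: prod.distrib power3_eq_cube)
    also have "\<dots> = 2 * \<i> * (qpow \<tau> (1 / 8) ^ 3 * qpow \<tau> (- (1 / 2))) * E ^ 3 *
        (R\<^sup>2 * ((1 - q) * (\<Prod>k<n. (1 - q ^ (2 * k + 3)) * (1 - q ^ (2 * k + 1)))))"
      unfolding st fac by (simp only: mult_ac)
    also have "\<dots> = 2 * \<i> * qpow \<tau> (- (1 / 8)) * E ^ 3 * ((R * Q)\<^sup>2 * (1 - q ^ (2 *
        n + 1)))"
      unfolding k3 prod_odd_powers Q_def[symmetric] by (simp only: power_mult_distrib mult_ac)
    finally show ?thesis
      unfolding RQ by (simp only: R_def)
  qed
  have lims: "filterlim (\<lambda>n::nat. 2 * n) sequentially sequentially"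
    "filterlim (\<lambda>n::nat. 2 * n + 1) sequentially sequentially"
    by real_asymp+
  have "(\<lambda>n. 2 * \<i> * qpow \<tau> (- (1 / 8)) * E ^ 3 * ((qfact q (2 * n) / qfact q
      n)\<^sup>2 * (1 - q ^ (2 * n + 1))))
      \<longlonglongrightarrow> 2 * \<i> * qpow \<tau> (- (1 / 8)) * E ^ 3 * ((E / E)\<^sup>2 * (1 -
          0))"
    unfolding E_def using euler_prod_neq_0[OF q(1)]
    by (intro tendsto_intros filterlim_compose[OF qfact_tendsto[OF q(1)]] lims qfact_tendsto[OF q(1)]
        filterlim_compose[OF LIMSEQ_power_zero[OF q(1)]])
  moreover have "(\<lambda>n. 2 * \<i> * qpow \<tau> (- (1 / 8)) * E ^ 3 * ((qfact q (2 * n) / qfact q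
      n)\<^sup>2 * (1 - q ^ (2 * n + 1))))
      \<longlonglongrightarrow> \<theta> (of_real pi / 2) * \<theta> (of_real pi * \<tau> / 2) *
          \<theta> (of_real pi / 2 + of_real pi * \<tau> / 2)"
    using tendsto_mult[OF tendsto_mult[OF lim1 lim2] lim3] unfolding partial .
  ultimately show ?thesis
    using E LIMSEQ_unique by (fastforce simp: E_def)
qed

section \<open>Theta values at multiples of \<pi>/5\<close>

definition p :: complex where
  "p = of_real pi / 5"

definition a :: complex where
  "a = \<theta> p"

definition b :: complex where
  "b = \<theta> (2 * p)"

lemma not_in_lattice: "p \<notin> period_lattice \<tau>" "2 * p \<notin> period_lattice \<tau>"
proof -
  have "of_nat k * p \<notin> period_lattice \<tau>" if "0 < k" "k < 5" for k :: nat
  proof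
    assume "of_nat k * p \<in> period_lattice \<tau>"
    then obtain m n where "of_nat k * p = of_int m * of_real pi + of_int n * (of_real pi * \<tau>)"
      by (auto simp: period_lattice_def)
    then have "real k * pi / 5 = real_of_int m * pi + real_of_int n * (pi * Re \<tau>)" "real_of_int n
        * (pi * Im \<tau>) = 0"
      by (auto simp: complex_eq_iff p_def)
    then have "real k = real_of_int (5 * m)"
      using im_pos by (simp add: field_simps)
    then have "int k = 5 * m"
      by (metis of_int_eq_iff of_int_of_nat_eq)
    then show False
      using that by presburger
  qed
  from this[of 1] this[of 2] show "p \<notin> period_lattice \<tau>" "2 * p \<notin> period_lattice
      \<tau>"
    by simp_all
qed

lemma a_neq_0: "a \<noteq> 0" and b_neq_0: "b \<noteq> 0"
  using not_in_lattice theta1_eq_0_iff[OF im_pos] by (auto simp: a_def b_def)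

lemma theta1_multiples:
  "\<theta> p = a" "\<theta> (2 * p) = b" "\<theta> (3 * p) = b" "\<theta> (4 * p) = a"
  "\<theta> (- p) = - a" "\<theta> (- (2 * p)) = - b" 
proof -
  have "3 * p = of_real pi - 2 * p" "4 * p = of_real pi - p"
    by (simp_all add: p_def)
  then show "\<theta> (3 * p) = b" "\<theta> (4 * p) = a"
    by (simp_all only: theta1_minus_pi a_def b_def)
qed (simp_all add: a_def b_def theta1_minus')

text \<open>The triple products at p and 2p combine by \<open>prod_quintic_factors\<close>. The
  prefactor 4 sin p sin (2p) is the square root of 5, and squaring makes it rational.\<close>

lemma ab_squared: "(a * b)\<^sup>2 = 5 * (dedekind_eta \<tau> * dedekind_eta (5 * \<tau>))\<^sup>2"
proof -
  define E where "E = euler_prod q"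
  define E5 where "E5 = euler_prod (q ^ 5)"
  have q5: "norm (q ^ 5) < 1"
    using q(1) by (simp add: norm_power power_less_one_iff)
  define c where "c = cos (2 * pi / 5)"
  define d where "d = cos (4 * pi / 5)"
  note cd = cos_two_fifths_pi[folded c_def d_def]
  have cos: "cos (2 * p) = of_real c" "cos (2 * (2 * p)) = of_real d"
    unfolding c_def d_def p_def by (simp_all flip: cos_of_real)
  let ?s = "sin p * sin (2 * p)"
  have "(\<lambda>n. 4 * qpow \<tau> (1 / 8) ^ 2 * E\<^sup>2 * ?s * (qfact (q ^ 5) n / qfact q n))
      \<longlonglongrightarrow> 4 * qpow \<tau> (1 / 8) ^ 2 * E\<^sup>2 * ?s * (E5 / E)"
    unfolding E_def E5_def using euler_prod_neq_0[OF q(1)]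
    by (intro tendsto_intros qfact_tendsto q q5)
  moreover have "(\<lambda>n. 4 * qpow \<tau> (1 / 8) ^ 2 * E\<^sup>2 * ?s * (qfact (q ^ 5) n / qfact q
      n)) \<longlonglongrightarrow> a * b"
    using tendsto_mult[OF theta1_tendsto[of p] theta1_tendsto[of "2 * p"]]
    unfolding cos theta1_multiples prod_quintic_factors[OF q(1) cd, symmetric]
    by (simp only: E_def[symmetric] power2_eq_square mult_ac numeral_times_numeral) (simp add: mult_ac)
  ultimately have "a * b = 4 * qpow \<tau> (1 / 8) ^ 2 * E\<^sup>2 * ?s * (E5 / E)"
    by (rule LIMSEQ_unique[symmetric])
  then have ab: "a * b = 4 * ?s * (qpow \<tau> (1 / 8) ^ 2 * E * E5)"
    using euler_prod_neq_0[OF q(1)] by (simp add: E_def power2_eq_square)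
  have s2: "16 * ?s\<^sup>2 = 5"
  proof -
    have "cos (2 * p) = 1 - 2 * (sin p)\<^sup>2" "cos (2 * (2 * p)) = 1 - 2 * (sin (2 * p))\<^sup>2"
      by (rule cos_double_sin)+
    then have "16 * ?s\<^sup>2 = 4 * ((1 - cos (2 * p)) * (1 - cos (2 * (2 * p))))"
      by (simp add: power_mult_distrib)
    also have "\<dots> = of_real (4 * (1 - (c + d) + c * d))"
      unfolding cos by (simp add: algebra_simps)
    also have "\<dots> = 5"
      unfolding cd by simp
    finally show ?thesis .
  qed
  have "qpow (5 * \<tau>) r = qpow \<tau> (5 * r)" for r
    by (simp add: qpow_def mult_ac)
  then have eta5: "dedekind_eta (5 * \<tau>) = qpow \<tau> (5 / 24) * E5"
    by (simp add: dedekind_eta_eq E5_def q_def qpow_power)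
  have "qpow \<tau> (1 / 8) ^ 2 = qpow \<tau> (1 / 24) * qpow \<tau> (5 / 24)"
    by (simp add: qpow_power flip: qpow_add)
  then have "a * b = 4 * ?s * (dedekind_eta \<tau> * dedekind_eta (5 * \<tau>))"
    unfolding ab eta5 unfolding dedekind_eta_eq by (simp add: E_def q_def)
  then have "(a * b)\<^sup>2 = 16 * ?s\<^sup>2 * (dedekind_eta \<tau> * dedekind_eta (5 *
      \<tau>))\<^sup>2"
    by (simp add: power_mult_distrib)
  then show ?thesis
    unfolding s2 .
qed

section \<open>Addition formulas\<close>

lemmas theta_function_theta1' = theta_function_theta1[OF im_pos]

lemma theta_function_pair: "theta_function \<tau> 2 0 (\<lambda>z. \<theta> (z + s) * \<theta> (z - s))"
  using theta_function_mult[OF theta_function_theta1'[of s] theta_function_theta1'[of "- s"]]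
  by (simp add: numeral_2_eq_2)

text \<open>The shifts s, s, -2s add up to 0, so the products for s and -s have the same multipliers
  and may be added or subtracted.\<close>

lemma theta_function_triple: "theta_function \<tau> 3 0 (\<lambda>z. (\<theta> (z + s))\<^sup>2 *
    \<theta> (z - 2 * s))"
  using theta_function_mult[OF theta_function_power[OF theta_function_theta1'[of s], of 2]
      theta_function_theta1'[of "- (2 * s)"]]
  by (simp add: numeral_3_eq_3)

lemma theta_function_id: "theta_function \<tau> 1 0 \<theta>"
  using theta_function_theta1'[of 0] by simp

lemma simple_zeros_shift: "simple_zeros (\<lambda>z. \<theta> (z + s))"
  using simple_zeros_compose_affine[OF theta1_holomorphic[OF im_pos] simple_zeros_theta1[OF im_pos], of
      1 s]
  by simp

lemma holomorphic_shift: "(\<lambda>z. \<theta> (z + s)) holomorphic_on UNIV"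
  by (rule theta_function_holomorphic[OF theta_function_theta1'])

lemma simple_zeros_pair:
  assumes "\<theta> (2 * s) \<noteq> 0"
  shows "simple_zeros (\<lambda>z. \<theta> (z + s) * \<theta> (z - s))"
proof (rule simple_zeros_mult)
  show "\<theta> (z - s) \<noteq> 0" if "\<theta> (z + s) = 0" for z
  proof
    assume "\<theta> (z - s) = 0"
    with theta1_diff_eq_0[OF im_pos that] have "\<theta> ((z + s) - (z - s)) = 0"
      by blast
    moreover have "(z + s) - (z - s) = 2 * s"
      by simp
    ultimately show False
      using assms by (simp only:)
  qed
qed (use simple_zeros_shift[of s] simple_zeros_shift[of "- s"] holomorphic_shift[of s]
    holomorphic_shift[of "- s"] in simp_all)

text \<open>Weierstrass's three-term relation. The assumption separates the zeros s and -s of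
  \<open>?G\<close>, so that they are simple; the constant is read off at z = 0.\<close>

lemma theta1_addition:
  assumes "\<theta> (2 * s) \<noteq> 0"
  shows "\<theta> (x + s) * \<theta> (x - s) * (\<theta> y)\<^sup>2 - (\<theta> x)\<^sup>2 * (\<theta>
      (y + s) * \<theta> (y - s))
           = (\<theta> s)\<^sup>2 * (\<theta> (x + y) * \<theta> (x - y))"
proof -
  let ?F = "\<lambda>z. (\<theta> (y + s) * \<theta> (y - s)) * (\<theta> (z + 0) * \<theta> (z - 0)) +
      (\<theta> s)\<^sup>2 * (\<theta> (z + y) * \<theta> (z - y))"
  let ?G = "\<lambda>z. \<theta> (z + s) * \<theta> (z - s)"
  have s: "\<theta> s \<noteq> 0"
    using assms theta1_double_eq_0 by blast
  have F: "theta_function \<tau> 2 0 ?F"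
    by (intro theta_function_add theta_function_cmult theta_function_pair)
  have ms: "\<theta> (s - y) = - \<theta> (y - s)" "\<theta> (- s - y) = - \<theta> (y + s)" "\<theta>
      (- s + y) = \<theta> (y - s)"
    using theta1_minus'[of "y - s"] theta1_minus'[of "y + s"] by (simp_all add: algebra_simps)
  have "?F z = 0" if "?G z = 0" for z
  proof -
    have "?F s = 0" "?F (- s) = 0"
      unfolding ms by (simp_all add: ms theta1_minus' power2_eq_square add.commute)
    then show ?thesis
      using theta_function_eq_0[OF im_pos F, of z s] theta_function_eq_0[OF im_pos F, of z "- s"] that
      by auto
  qed
  then obtain c where c: "\<And>z. ?F z = c * ?G z"
    using theta_function_proportional[OF im_pos F theta_function_pair simple_zeros_pair[OF assms]] by
        blast
  have "c = (\<theta> y)\<^sup>2"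
    using c[of 0] s by (simp add: theta1_minus' power2_eq_square)
  with c[of x] show ?thesis
    by (simp add: power2_eq_square algebra_simps)
qed

text \<open>The bracket alone vanishes at 0; the relative weight of the cube of \<theta> is the one
  that makes \<open>?F\<close> vanish also at p and -p. Evaluation at 2p then gives the constant a^5
  + b^5.\<close>

lemma theta1_cubic_sum:
  "a ^ 3 * b\<^sup>2 * ((\<theta> (x + p))\<^sup>2 * \<theta> (x - 2 * p) + (\<theta> (x - p))\<^sup>2
      * \<theta> (x + 2 * p)) + a * b ^ 4 * \<theta> x ^ 3
     = (a ^ 5 + b ^ 5) * (\<theta> x * (\<theta> (x + p) * \<theta> (x - p)))"
proof -
  let ?F = "\<lambda>z. a ^ 3 * b\<^sup>2 * ((\<theta> (z + p))\<^sup>2 * \<theta> (z - 2 * p) +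
      (\<theta> (z - p))\<^sup>2 * \<theta> (z + 2 * p)) + a * b ^ 4 * \<theta> z ^ 3"
  let ?G = "\<lambda>z. \<theta> z * (\<theta> (z + p) * \<theta> (z - p))"
  have 1: "theta_function \<tau> 3 0 (\<lambda>z. \<theta> z ^ 3)"
    using theta_function_power[OF theta_function_id, of 3] by simp
  have F: "theta_function \<tau> 3 0 ?F"
    using theta_function_triple[of p] theta_function_triple[of "- p"] 1 by (intro theta_function_add
        theta_function_cmult) simp_all
  have G: "theta_function \<tau> 3 0 ?G"
    using theta_function_mult[OF theta_function_id theta_function_pair[of p]] by (simp add:
        numeral_3_eq_3 numeral_2_eq_2)
  have sG: "simple_zeros ?G"
  proof (rule simple_zeros_mult)
    show "\<theta> (z + p) * \<theta> (z - p) \<noteq> 0" if "\<theta> z = 0" for z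
      using theta1_diff_eq_0[OF im_pos _ that, of "z + p"] theta1_diff_eq_0[OF im_pos that, of "z - p"]
          a_neq_0
      by (auto simp: a_def)
    show "simple_zeros (\<lambda>z. \<theta> (z + p) * \<theta> (z - p))"
      by (rule simple_zeros_pair) (simp add: theta1_multiples b_neq_0)
  qed (use theta_function_holomorphic[OF theta_function_pair] theta_function_holomorphic[OF
      theta_function_id]
       simple_zeros_theta1[OF im_pos] in auto)
  have pp: "p - 2 * p = - p" "p + 2 * p = 3 * p" "- p - 2 * p = - (3 * p)" "- p + 2 * p = p" "- p - p =
      - (2 * p)" "p + p = 2 * p"
     "2 * p + p = 3 * p" "2 * p - p = p" "2 * p + 2 * p = 4 * p"
    by simp_all
  have "?F 0 = 0" "?F p = 0" "?F (- p) = 0"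
    by (simp_all add: theta1_multiples pp theta1_minus' power2_eq_square power3_eq_cube power4_eq_xxxx)
  then have "?F z = 0" if "?G z = 0" for z
    using theta_function_eq_0[OF im_pos F, of z 0] theta_function_eq_0[OF im_pos F, of z p]
      theta_function_eq_0[OF im_pos F, of z "- p"] that by auto
  then obtain c where c: "\<And>z. ?F z = c * ?G z"
    using theta_function_proportional[OF im_pos F G sG] by blast
  have "a ^ 3 * b\<^sup>2 * (a\<^sup>2 * a) + a * b ^ 4 * b ^ 3 = c * (b * (b * a))"
    using c[of "2 * p"] by (simp add: theta1_multiples pp)
  then have "(a ^ 5 + b ^ 5) * (a * b\<^sup>2) = c * (a * b\<^sup>2)"
    by (simp add: algebra_simps eval_nat_numeral)
  then have "c = a ^ 5 + b ^ 5"
    using a_neq_0 b_neq_0 by simp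
  then show ?thesis
    using c[of x] by simp
qed

text \<open>An affine function of the Weierstrass function of the lattice, normalised to vanish at p
  and -p. Its half-period values stand in for the classical roots of the Weierstrass cubic.\<close>

definition u :: "complex \<Rightarrow> complex" where
  "u h = \<theta> (h + p) * \<theta> (h - p) / (\<theta> h)\<^sup>2"

lemma u_diff:
  assumes "\<theta> h \<noteq> 0" "\<theta> k \<noteq> 0"
  shows "u h - u k = a\<^sup>2 * (\<theta> (h + k) * \<theta> (h - k)) / ((\<theta> h)\<^sup>2 *
      (\<theta> k)\<^sup>2)"
proof -
  have "\<theta> (h + p) * \<theta> (h - p) * (\<theta> k)\<^sup>2 - (\<theta> h)\<^sup>2 * (\<theta>
      (k + p) * \<theta> (k - p)) = a\<^sup>2 * (\<theta> (h + k) * \<theta> (h - k))"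
    using theta1_addition[of p h k] by (simp add: theta1_multiples b_neq_0)
  then show ?thesis
    unfolding u_def using assms by (simp add: diff_frac_eq mult_ac)
qed

text \<open>The two functions \<open>\<theta>(\<plusminus>x + p)\<^sup>2 \<theta>(\<plusminus>x - 2p) / \<theta>(\<plusminus>x)\<^sup>3\<close> agree at half-periods; their sum is linear in \<open>u\<close>
  and their product is cubic in \<open>u\<close>.\<close>

lemma half_period_cubic:
  assumes "\<theta> (2 * h) = 0" "\<theta> h \<noteq> 0"
  shows "((a ^ 5 + b ^ 5) * u h - a * b ^ 4)\<^sup>2 = 4 * a ^ 4 * b ^ 4 * (u h)\<^sup>2 * (b\<^sup>2 *
      u h - a * b)"
proof -
  define A where "A = \<theta> h"
  define B where "B = \<theta> (h + p) * \<theta> (h - p)"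
  define C where "C = \<theta> (h + 2 * p) * \<theta> (h - 2 * p)"
  define N where "N = (\<theta> (h + p))\<^sup>2 * \<theta> (h - 2 * p)"
  \<comment> \<open>\<open>?V\<close> is even of odd degree 3. The additional factor \<theta> turns
    it into an odd function of even degree, which must vanish at half-periods.\<close>
  let ?V = "\<lambda>z. (\<theta> (z + p))\<^sup>2 * \<theta> (z - 2 * p) - (\<theta> (z - p))\<^sup>2
      * \<theta> (z + 2 * p)"
  have "theta_function \<tau> 3 0 ?V"
    using theta_function_diff[OF theta_function_triple[of p] theta_function_triple[of "- p"]] by simp
  from theta_function_mult[OF this theta_function_id]
  have V: "theta_function \<tau> 4 0 (\<lambda>z. ?V z * \<theta> z)"
    by simp
  have "?V (- z) * \<theta> (- z) = - (?V z * \<theta> z)" for z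
  proof -
    have "\<theta> (- z + p) = - \<theta> (z - p)" "\<theta> (- z - p) = - \<theta> (z + p)"
      "\<theta> (- z + 2 * p) = - \<theta> (z - 2 * p)" "\<theta> (- z - 2 * p) = - \<theta> (z + 2 *
          p)"
      using theta1_minus'[of "z - p"] theta1_minus'[of "z + p"]
        theta1_minus'[of "z - 2 * p"] theta1_minus'[of "z + 2 * p"]
      by simp_all
    then show ?thesis
      by (simp add: theta1_minus' algebra_simps)
  qed
  then have "?V h * \<theta> h = 0"
    by (intro odd_theta_function_half_period[OF im_pos V _ _ assms(1)]) simp_all
  then have N': "N = (\<theta> (h - p))\<^sup>2 * \<theta> (h + 2 * p)"
    using assms(2) by (simp add: N_def)
  \<comment> \<open>The two equal expressions for N are multiplied with each other; C is then linear
    in B by the addition formula, which makes the right-hand side cubic.\<close>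
  have N2: "N\<^sup>2 = B\<^sup>2 * C"
  proof -
    have "N\<^sup>2 = N * ((\<theta> (h - p))\<^sup>2 * \<theta> (h + 2 * p))"
      using N' by (simp add: power2_eq_square)
    then show ?thesis
      by (simp add: N_def B_def C_def power2_eq_square mult_ac)
  qed
  have S: "a ^ 3 * b\<^sup>2 * (2 * N) + a * b ^ 4 * A ^ 3 = (a ^ 5 + b ^ 5) * (A * B)"
    using theta1_cubic_sum[of h] unfolding N'[symmetric] unfolding N_def[symmetric] A_def B_def by simp
  have C: "b\<^sup>2 * B - a * b * A\<^sup>2 = a\<^sup>2 * C"
  proof -
    have "2 * p + p = 3 * p" "2 * p - p = p"
      by simp_all
    then have "B * b\<^sup>2 - A\<^sup>2 * (b * a) = a\<^sup>2 * C"
      using theta1_addition[of p h "2 * p"] by (simp add: theta1_multiples b_neq_0 A_def B_def C_def)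
    then show ?thesis
      by (simp add: mult_ac)
  qed
  have "((a ^ 5 + b ^ 5) * (A * B) - a * b ^ 4 * A ^ 3)\<^sup>2 = (2 * a ^ 3 * b\<^sup>2 * N)\<^sup>2"
    unfolding S[symmetric] by (simp add: mult_ac)
  also have "\<dots> = 4 * a ^ 4 * b ^ 4 * (a\<^sup>2 * C) * B\<^sup>2"
    unfolding power_mult_distrib N2 by (simp add: algebra_simps eval_nat_numeral)
  finally have *: "((a ^ 5 + b ^ 5) * (A * B) - a * b ^ 4 * A ^ 3)\<^sup>2 = 4 * a ^ 4 * b ^ 4 *
      (b\<^sup>2 * B - a * b * A\<^sup>2) * B\<^sup>2"
    unfolding C .
  have B: "B = u h * A\<^sup>2"
    using assms(2) by (simp add: u_def A_def B_def)
  have "A ^ 6 * ((a ^ 5 + b ^ 5) * u h - a * b ^ 4)\<^sup>2 = A ^ 6 * (4 * a ^ 4 * b ^ 4 * (u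
      h)\<^sup>2 * (b\<^sup>2 * u h - a * b))"
    using * unfolding B by algebra
  then show ?thesis
    using assms(2) by (simp add: A_def)
qed

lemma theta1_power5_relation: "dedekind_eta \<tau> ^ 12 * (b ^ 10 - 11 * a ^ 5 * b ^ 5 - a ^ 10) = a ^
    11 * b ^ 11"
proof -
  define h1 h2 h3 :: complex
    where "h1 = of_real pi / 2" and "h2 = of_real pi * \<tau> / 2" and "h3 = of_real pi / 2 + of_real
        pi * \<tau> / 2"
  define e1 e2 e3 where "e1 = \<theta> h1" and "e2 = \<theta> h2" and "e3 = \<theta> h3"
  define r where "r = qpow \<tau> (- (1 / 2))"
  define E where "E = euler_prod q"
  have prod: "e1 * e2 * e3 = 2 * \<i> * qpow \<tau> (- (1 / 8)) * E ^ 3"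
    using prod_theta1_half_periods unfolding e1_def e2_def e3_def h1_def h2_def h3_def E_def .
  have nz: "e1 \<noteq> 0" "e2 \<noteq> 0" "e3 \<noteq> 0"
    using prod euler_prod_neq_0[OF q(1)] by (auto simp: E_def)
  have tp: "\<theta> (z + of_real pi) = - \<theta> z" for z
    by (rule theta1_plus_pi[OF im_pos])
  have tpt: "\<theta> (z + of_real pi * \<tau>) = - (exp (- (2 * \<i> * z)) * r * \<theta> z)" for z
    unfolding r_def by (rule theta1_plus_pi_tau[OF im_pos])
  have "2 * h1 = of_real pi" "2 * h2 = of_real pi * \<tau>" "2 * h3 = of_real pi + of_real pi * \<tau>"
    by (simp_all add: h1_def h2_def h3_def add_divide_distrib)
  then have zero: "\<theta> (2 * h1) = 0" "\<theta> (2 * h2) = 0" "\<theta> (2 * h3) = 0"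
    using tp[of 0] tpt[of 0] tpt[of "of_real pi"] by simp_all
  have u12: "u h1 - u h2 = a\<^sup>2 * e3\<^sup>2 / (e1\<^sup>2 * e2\<^sup>2)"
  proof -
    have "h1 - h2 + of_real pi * \<tau> = h3"
      by (simp add: h1_def h2_def h3_def field_simps)
    then have "e3 = - (exp (- (2 * \<i> * (h1 - h2))) * r) * \<theta> (h1 - h2)"
      using tpt[of "h1 - h2"] by (simp add: e3_def)
    also have "exp (- (2 * \<i> * (h1 - h2))) * r = exp (- (of_real pi * \<i>))"
      by (simp add: h1_def h2_def r_def qpow_def field_simps flip: exp_add)
    also have "\<dots> = - 1"
      by (simp add: exp_minus)
    finally have "\<theta> (h1 - h2) = e3"
      by simp
    moreover have "h1 + h2 = h3"
      by (simp add: h1_def h2_def h3_def)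
    ultimately show ?thesis
      using u_diff[of h1 h2] nz by (simp add: e1_def e2_def e3_def power2_eq_square)
  qed
  have u13: "u h1 - u h3 = a\<^sup>2 * e2\<^sup>2 / (e1\<^sup>2 * e3\<^sup>2)"
  proof -
    have "h1 + h3 = h2 + of_real pi" "h1 - h3 = - h2"
      by (simp_all add: h1_def h2_def h3_def field_simps)
    then have "\<theta> (h1 + h3) = - e2" "\<theta> (h1 - h3) = - e2"
      by (simp_all only: tp theta1_minus' e2_def)
    then show ?thesis
      using u_diff[of h1 h3] nz by (simp add: e1_def e3_def power2_eq_square)
  qed
  \<comment> \<open>Here the factor r = q^(-1/2) survives: h2 + h3 is h1 moved by the quasi-period.
    For h1 - h2 the corresponding multiplier reduced to a sign.\<close>
  have u23: "u h2 - u h3 = - (r * a\<^sup>2 * e1\<^sup>2 / (e2\<^sup>2 * e3\<^sup>2))"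
  proof -
    have "h2 + h3 = h1 + of_real pi * \<tau>" "h2 - h3 = - h1"
      by (simp_all add: h1_def h2_def h3_def field_simps)
    then have "\<theta> (h2 + h3) = - (exp (- (2 * \<i> * h1)) * r * e1)" "\<theta> (h2 - h3) = - e1"
      by (simp_all only: tpt theta1_minus' e1_def)
    moreover have "exp (- (2 * \<i> * h1)) = - 1"
    proof -
      have "2 * \<i> * h1 = of_real pi * \<i>"
        by (simp add: h1_def)
      then show ?thesis
        by (simp only: exp_minus exp_pi_i) simp
    qed
    ultimately show ?thesis
      using u_diff[of h2 h3] nz by (simp add: e2_def e3_def power2_eq_square mult_ac)
  qed
  have r2: "r\<^sup>2 = qpow \<tau> (- 1)"
    by (simp add: r_def qpow_power)
  define D where "D = (u h1 - u h2) * (u h1 - u h3) * (u h2 - u h3)"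
  \<comment> \<open>Each difference has one of the e_i^2 above and the other two below, so the
    product of all three contains every e_i^2 once above and twice below.\<close>
  have "D * (e1 * e2 * e3)\<^sup>2 = - (r * a ^ 6)"
    unfolding D_def u12 u13 u23 using nz by (simp add: field_simps eval_nat_numeral)
  then have "(D * (e1 * e2 * e3)\<^sup>2)\<^sup>2 = qpow \<tau> (- 1) * a ^ 12"
    by (simp add: power_mult_distrib r2 flip: power_mult)
  moreover have "(D * (e1 * e2 * e3)\<^sup>2)\<^sup>2 = D\<^sup>2 * (e1 * e2 * e3) ^ 4"
    by (simp add: power_mult_distrib flip: power_mult)
  moreover have "(e1 * e2 * e3) ^ 4 = 16 * (qpow \<tau> (- 1) * dedekind_eta \<tau> ^ 12)"
  proof -
    have "(e1 * e2 * e3) ^ 4 = 16 * (qpow \<tau> (- (1 / 8)) ^ 4 * E ^ 12)"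
      unfolding prod by (simp add: power_mult_distrib flip: power_mult)
    also have "qpow \<tau> (- (1 / 8)) ^ 4 = qpow \<tau> (- 1) * qpow \<tau> (1 / 24) ^ 12"
      by (simp add: qpow_power flip: qpow_add)
    finally show ?thesis
      by (simp add: dedekind_eta_eq E_def q_def power_mult_distrib)
  qed
  ultimately have "qpow \<tau> (- 1) * (16 * dedekind_eta \<tau> ^ 12 * D\<^sup>2) = qpow \<tau> (- 1)
      * a ^ 12"
    by (simp add: mult_ac)
  then have D: "16 * dedekind_eta \<tau> ^ 12 * D\<^sup>2 = a ^ 12"
    by (subst (asm) mult_left_cancel) simp_all
  \<comment> \<open>The differences need no separate argument: a \<noteq> 0 forces D \<noteq>
    0.\<close>
  have ne: "u h1 \<noteq> u h2" "u h1 \<noteq> u h3" "u h2 \<noteq> u h3"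
    using D a_neq_0 by (auto simp: D_def)
  \<comment> \<open>The coefficients of right-hand side minus left-hand side of
    \<open>half_period_cubic\<close>, ordered by powers of \<open>u h\<close>.\<close>
  define c3 c2 c1 c0 where "c3 = 4 * a ^ 4 * b ^ 6" and "c2 = - 4 * a ^ 5 * b ^ 5 - (a ^ 5 + b ^
      5)\<^sup>2"
    and "c1 = 2 * (a ^ 5 + b ^ 5) * (a * b ^ 4)" and "c0 = - (a\<^sup>2 * b ^ 8)"
  have cubic: "c3 * u h ^ 3 + c2 * (u h)\<^sup>2 + c1 * u h + c0 = 0" if "\<theta> (2 * h) = 0"
      "\<theta> h \<noteq> 0" for h
    using half_period_cubic[OF that] unfolding c3_def c2_def c1_def c0_def by algebra
  have "c2\<^sup>2 * c1\<^sup>2 - 4 * c3 * c1 ^ 3 - 4 * c2 ^ 3 * c0 - 27 * c3\<^sup>2 * c0\<^sup>2 + 18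
      * c3 * c2 * c1 * c0 = c3 ^ 4 * D\<^sup>2"
    unfolding D_def using nz zero ne
    by (intro discriminant_cubic cubic) (simp_all add: e1_def e2_def e3_def)
  \<comment> \<open>In t = (b/a)^5 the last factor is a^10 (t^2 - 11 t - 1), which is characteristic
    of curves with a point of order 5.\<close>
  moreover have "c2\<^sup>2 * c1\<^sup>2 - 4 * c3 * c1 ^ 3 - 4 * c2 ^ 3 * c0 - 27 * c3\<^sup>2 *
      c0\<^sup>2 + 18 * c3 * c2 * c1 * c0
      = 16 * a ^ 17 * b ^ 13 * (b ^ 10 - 11 * a ^ 5 * b ^ 5 - a ^ 10)"
    unfolding c3_def c2_def c1_def c0_def by algebra
  ultimately have "16 * dedekind_eta \<tau> ^ 12 * (16 * a ^ 17 * b ^ 13 * (b ^ 10 - 11 * a ^ 5 * b ^ 5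
      - a ^ 10))
      = c3 ^ 4 * (16 * dedekind_eta \<tau> ^ 12 * D\<^sup>2)"
    by simp
  also have "\<dots> = 256 * a ^ 17 * b ^ 13 * (a ^ 11 * b ^ 11)"
    unfolding D c3_def by (simp add: power_mult_distrib flip: power_mult power_add) (simp add: mult_ac
        flip: power_mult power_add)
  finally have "(256 * a ^ 17 * b ^ 13) * (dedekind_eta \<tau> ^ 12 * (b ^ 10 - 11 * a ^ 5 * b ^ 5 - a
      ^ 10))
      = (256 * a ^ 17 * b ^ 13) * (a ^ 11 * b ^ 11)"
    by (simp only: mult_ac) (simp add: mult_ac)
  then show ?thesis
    by (subst (asm) mult_left_cancel) (simp_all add: a_neq_0 b_neq_0)
qed

section \<open>The determinant of quintic differences\<close>

definition \<phi> :: "complex \<Rightarrow> complex \<Rightarrow> complex" where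
  "\<phi> s z = \<theta> (z + s) ^ 5 - \<theta> (z - s) ^ 5"

definition \<Phi> :: "complex \<Rightarrow> complex \<Rightarrow> complex" where
  "\<Phi> x y = \<phi> p x * \<phi> (2 * p) y - \<phi> p y * \<phi> (2 * p) x"

lemma \<Phi>_swap: "\<Phi> x y = - \<Phi> y x"
  by (simp add: \<Phi>_def)

lemma \<phi>_minus: "\<phi> s (- z) = \<phi> s z"
proof -
  have "\<theta> (- z + s) = - \<theta> (z - s)" "\<theta> (- z - s) = - \<theta> (z + s)"
    using theta1_minus'[of "z - s"] theta1_minus'[of "z + s"] by simp_all
  then show ?thesis
    by (simp add: \<phi>_def power_minus_odd)
qed

lemma theta_function_\<phi>:
  assumes "5 * s = of_int m * of_real pi"
  shows "theta_function \<tau> 5 0 (\<phi> s)"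
proof -
  have *: "theta_function \<tau> 5 0 (\<lambda>z. \<theta> (z + s) ^ 5)" if "5 * s = of_int m * of_real
      pi" for s m
    using theta_function_power[OF theta_function_theta1'[of s], of 5]
      theta_function_add_of_int_pi[of \<tau> 5 0 m] that by simp
  have "theta_function \<tau> 5 0 (\<lambda>z. \<theta> (z + s) ^ 5 - \<theta> (z + - s) ^ 5)"
    using assms by (intro theta_function_diff *[of s m] *[of "- s" "- m"]) simp_all
  then show ?thesis
    by (simp add: \<phi>_def[abs_def])
qed

lemma theta_function_\<phi>_p: "theta_function \<tau> 5 0 (\<phi> p)" "theta_function \<tau> 5 0
    (\<phi> (2 * p))"
  by (rule theta_function_\<phi>[of _ 1] theta_function_\<phi>[of _ 2], simp add: p_def)+

text \<open>\<open>\<phi> s\<close> is even of odd degree 5, so it is multiplied by \<theta> to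
  become odd of degree 6; \<theta> y \<noteq> 0 allows dividing again.\<close>

lemma \<phi>_half_period:
  assumes "theta_function \<tau> 5 0 (\<phi> s)" "\<theta> (2 * y) = 0" "\<theta> y \<noteq> 0"
  shows "\<phi> s y = 0"
proof -
  have "theta_function \<tau> 6 0 (\<lambda>z. \<phi> s z * \<theta> z)"
    using theta_function_mult[OF assms(1) theta_function_id] by simp
  from odd_theta_function_half_period[OF im_pos this _ _ assms(2)] show ?thesis
    using assms(3) by (simp add: \<phi>_minus theta1_minus')
qed

text \<open>The assumption keeps y and -y away from the half-periods and from each other modulo the
  lattice, so that the zeros of \<open>?G\<close> are simple.\<close>

lemma \<Phi>_proportional:
  assumes "\<theta> (2 * y) \<noteq> 0"
  obtains c where "\<And>x. \<Phi> x y * \<theta> x = c * (\<theta> (x + y) * \<theta> (x - y) *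
      \<theta> (2 * x))"
proof -
  let ?F = "\<lambda>z. \<Phi> z y * \<theta> z"
  let ?G = "\<lambda>z. \<theta> (z + y) * \<theta> (z - y) * \<theta> (2 * z)"
  have "theta_function \<tau> 5 0 (\<lambda>z. \<phi> (2 * p) y * \<phi> p z - \<phi> p y * \<phi> (2 *
      p) z)"
    by (intro theta_function_diff theta_function_cmult theta_function_\<phi>_p)
  from theta_function_mult[OF this theta_function_id] have F: "theta_function \<tau> 6 0 ?F"
    by (simp add: \<Phi>_def mult.commute)
  have G: "theta_function \<tau> 6 0 ?G"
    using theta_function_mult[OF theta_function_pair[of y] theta_function_theta1_double[OF im_pos]] by
        simp
  have "simple_zeros (\<lambda>z. \<theta> (2 * z))"
    using simple_zeros_compose_affine[OF theta1_holomorphic[OF im_pos] simple_zeros_theta1[OF im_pos],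
        of 2 0]
    by simp
  then have sG: "simple_zeros ?G"
  proof (rule simple_zeros_mult[rotated 3])
    show "\<theta> (2 * z) \<noteq> 0" if "\<theta> (z + y) * \<theta> (z - y) = 0" for z
    proof
      assume 0: "\<theta> (2 * z) = 0"
      have "\<theta> (2 * (z + y) - 2 * z) = 0 \<or> \<theta> (2 * z - 2 * (z - y)) = 0"
        using that 0 theta1_double_eq_0[of "z + y"] theta1_double_eq_0[of "z - y"]
          theta1_diff_eq_0[OF im_pos, of "2 * (z + y)" "2 * z"] theta1_diff_eq_0[OF im_pos, of "2 * z"
              "2 * (z - y)"]
        by auto
      moreover have "2 * (z + y) - 2 * z = 2 * y" "2 * z - 2 * (z - y) = 2 * y"
        by simp_all
      ultimately show False
        using assms by (simp only: simp_thms)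
    qed
  qed (use theta_function_holomorphic[OF theta_function_pair] simple_zeros_pair[OF assms]
        theta_function_holomorphic[OF theta_function_theta1_double[OF im_pos]] in auto)
  have "?F z = 0" if "?G z = 0" for z
  proof -
    from that consider "\<theta> (z - - y) = 0" | "\<theta> (z - y) = 0" | "\<theta> (2 * z) = 0"
      by auto
    then show ?thesis
    proof cases
      case 3
      show ?thesis
        by (rule odd_theta_function_half_period[OF im_pos F _ _ 3])
           (simp_all add: \<Phi>_def \<phi>_minus theta1_minus')
    qed (erule theta_function_eq_0[OF im_pos F], simp add: \<Phi>_def \<phi>_minus)+
  qed
  then show ?thesis
    using theta_function_proportional[OF im_pos F G sG] that by blast
qed

text \<open>The constant of proportionality is found by setting \<open>x = p\<close>, or \<open>x = 2p\<close> if \<open>y\<close> is congruent to \<open>\<plusminus>p\<close>.\<close>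

lemma \<Phi>_eq:
  assumes "\<theta> (2 * y) \<noteq> 0"
  shows "a * b * (\<Phi> x y * \<theta> x * \<theta> y)
           = (b ^ 10 - a ^ 5 * b ^ 5 - a ^ 10) * (\<theta> (x + y) * \<theta> (x - y) * \<theta> (2 *
               x) * \<theta> (2 * y))"
proof -
  define \<Delta> where "\<Delta> = b ^ 10 - a ^ 5 * b ^ 5 - a ^ 10"
  have y: "\<theta> y \<noteq> 0"
    using assms theta1_double_eq_0 by blast
  obtain c where c: "\<And>x. \<Phi> x y * \<theta> x = c * (\<theta> (x + y) * \<theta> (x - y) *
      \<theta> (2 * x))"
    using \<Phi>_proportional[OF assms] by blast
  have pp: "2 * p + p = 3 * p" "2 * p - p = p" "2 * (2 * p) = 4 * p" "p + 2 * p = 3 * p" "p - 2 * p = -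
      p"
    "p + p = 2 * p" "2 * p + 2 * p = 4 * p" "p - p = 0"
    by simp_all
  \<comment> \<open>Here \<open>\<phi> p (2 * p)\<close> = b^5 - a^5,
    \<open>\<phi> (2 * p) p\<close> = b^5 + a^5, \<open>\<phi> p p\<close> = b^5 and
    \<open>\<phi> (2 * p) (2 * p)\<close> = a^5.\<close>
  have \<Phi>: "\<Phi> (2 * p) p = \<Delta>"
    unfolding \<Phi>_def \<phi>_def \<Delta>_def pp theta1_multiples by (simp add: algebra_simps
        power_minus_odd flip: power_add)
  obtain c1 where c1: "\<And>x. \<Phi> x p * \<theta> x = c1 * (\<theta> (x + p) * \<theta> (x - p) *
      \<theta> (2 * x))"
    using \<Phi>_proportional[of p] by (auto simp: theta1_multiples b_neq_0)
  obtain c2 where c2: "\<And>x. \<Phi> x (2 * p) * \<theta> x = c2 * (\<theta> (x + 2 * p) * \<theta>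
      (x - 2 * p) * \<theta> (2 * x))"
    using \<Phi>_proportional[of "2 * p"] by (auto simp: pp theta1_multiples a_neq_0)
  have C1: "c1 * a\<^sup>2 = \<Delta>"
    using c1[of "2 * p"] b_neq_0 by (simp add: pp theta1_multiples \<Phi> power2_eq_square)
  have C2: "c2 * b\<^sup>2 = \<Delta>"
    using c2[of p] a_neq_0 by (simp add: pp theta1_multiples \<Phi>_swap[of p] \<Phi> power2_eq_square)
  \<comment> \<open>\<Phi> s y is evaluated twice, with y as the parameter (constant c) and, by
    antisymmetry, with s as the parameter (constant c'); the common factor \<theta>(y+s)
    \<theta>(y-s) is cancelled.\<close>
  have anchor: "c * \<theta> y * \<theta> (2 * s) = \<theta> s * c' * \<theta> (2 * y)"
    if c': "\<And>x. \<Phi> x s * \<theta> x = c' * (\<theta> (x + s) * \<theta> (x - s) * \<theta> (2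
        * x))"
      and nz: "\<theta> (y + s) \<noteq> 0" "\<theta> (y - s) \<noteq> 0" for s c'
  proof -
    have m: "\<theta> (s - y) = - \<theta> (y - s)" "\<theta> (s + y) = \<theta> (y + s)"
      using theta1_minus'[of "y - s"] by (simp_all add: add.commute)
    have "(\<theta> (y + s) * \<theta> (y - s)) * (c * \<theta> y * \<theta> (2 * s)) = - (\<Phi> s y *
        \<theta> s * \<theta> y)"
      unfolding c m by (simp add: mult_ac)
    also have "\<dots> = \<Phi> y s * \<theta> y * \<theta> s"
      by (simp add: \<Phi>_swap[of s])
    also have "\<dots> = (\<theta> (y + s) * \<theta> (y - s)) * (\<theta> s * c' * \<theta> (2 * y))"
      unfolding c' by (simp add: mult_ac)
    finally show ?thesis
      using nz by (subst (asm) mult_left_cancel) simp_all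
  qed
  have cy: "a * b * (c * \<theta> y) = \<Delta> * \<theta> (2 * y)"
  proof (cases "\<theta> (y + p) = 0 \<or> \<theta> (y - p) = 0")
    case False
    then have "c * \<theta> y * b = a * c1 * \<theta> (2 * y)"
      using anchor[OF c1] by (simp add: theta1_multiples)
    then show ?thesis
      unfolding C1[symmetric] by algebra
  next
    case True
    \<comment> \<open>If y were congruent to one of p, -p and also to one of 2p, -2p, then \<theta>
      would vanish at p or 3p, where its values are a and b.\<close>
    have "\<theta> (y + 2 * p) \<noteq> 0 \<and> \<theta> (y - 2 * p) \<noteq> 0"
    proof (rule ccontr)
      assume "\<not> ?thesis"
      then have "\<theta> ((y + 2 * p) - (y + p)) = 0 \<or> \<theta> ((y + 2 * p) - (y - p)) = 0
          \<or> \<theta> ((y + p) - (y - 2 * p)) = 0 \<or> \<theta> ((y - p) - (y - 2 * p)) = 0"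
        using True theta1_diff_eq_0[OF im_pos] by blast
      moreover have "(y + 2 * p) - (y + p) = p" "(y + 2 * p) - (y - p) = 3 * p"
        "(y + p) - (y - 2 * p) = 3 * p" "(y - p) - (y - 2 * p) = p"
        by simp_all
      ultimately show False
        using a_neq_0 b_neq_0 by (simp only: theta1_multiples simp_thms)
    qed
    then have "c * \<theta> y * a = b * c2 * \<theta> (2 * y)"
      using anchor[OF c2] by (simp add: theta1_multiples pp)
    then show ?thesis
      unfolding C2[symmetric] by algebra
  qed
  have "a * b * (\<Phi> x y * \<theta> x * \<theta> y) = (a * b * (c * \<theta> y)) * (\<theta> (x + y)
      * \<theta> (x - y) * \<theta> (2 * x))"
    unfolding c by (simp add: mult_ac)
  then show ?thesis
    unfolding cy \<Delta>_def by (simp add: mult_ac)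
qed

text \<open>The left-hand side exceeds the discriminant factor by 10 a^5 b^5 = a b * 10 (a b)^4.
  With (a b)^2 = 5 (\<eta>(\<tau>) \<eta>(5\<tau>))^2 this term yields 250 = 10 * 25, and the
  discriminant relation yields 3125 = 5^5 through (a b)^10.\<close>

lemma eta_quotient_eq:
  "b ^ 10 - a ^ 5 * b ^ 5 - a ^ 10
     = a * b * (250 * dedekind_eta \<tau> ^ 4 * dedekind_eta (5 * \<tau>) ^ 4
           + 3125 * (dedekind_eta (5 * \<tau>) ^ 10 / dedekind_eta \<tau> ^ 2))"
proof -
  define \<eta> where "\<eta> = dedekind_eta \<tau>"
  define \<eta>5 where "\<eta>5 = dedekind_eta (5 * \<tau>)"
  have \<eta>: "\<eta> \<noteq> 0"
    unfolding \<eta>_def by (rule dedekind_eta_neq_0[OF im_pos])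
  have ab: "(a * b)\<^sup>2 = 5 * (\<eta> * \<eta>5)\<^sup>2"
    unfolding \<eta>_def \<eta>5_def by (rule ab_squared)
  have ab4: "(a * b) ^ 4 = 25 * (\<eta> ^ 4 * \<eta>5 ^ 4)"
    using arg_cong[OF ab, of "\<lambda>x. x ^ 2"] by (simp add: power_mult_distrib flip: power_mult)
  have ab10: "(a * b) ^ 10 = 3125 * (\<eta> ^ 10 * \<eta>5 ^ 10)"
    using arg_cong[OF ab, of "\<lambda>x. x ^ 5"] by (simp add: power_mult_distrib flip: power_mult)
  have "(b ^ 10 - 11 * a ^ 5 * b ^ 5 - a ^ 10) * \<eta> ^ 12 = a * b * (a * b) ^ 10"
    using theta1_power5_relation unfolding \<eta>_def[symmetric] by algebra
  then have "b ^ 10 - 11 * a ^ 5 * b ^ 5 - a ^ 10 = a * b * ((a * b) ^ 10 / \<eta> ^ 12)"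
    using \<eta> by (simp add: eq_divide_eq)
  also have "(a * b) ^ 10 / \<eta> ^ 12 = 3125 * (\<eta>5 ^ 10 / \<eta>\<^sup>2)"
    unfolding ab10 using \<eta> by (simp add: field_simps flip: power_add)
  finally have "b ^ 10 - a ^ 5 * b ^ 5 - a ^ 10 = a * b * (10 * (a * b) ^ 4 + 3125 * (\<eta>5 ^ 10 /
      \<eta>\<^sup>2))"
    by algebra
  then show ?thesis
    unfolding ab4 \<eta>_def \<eta>5_def by (simp add: mult_ac)
qed

lemma quintic_difference_identity:
  assumes "\<theta> x * \<theta> y \<noteq> 0"
  shows "\<Phi> x y = (250 * dedekind_eta \<tau> ^ 4 * dedekind_eta (5 * \<tau>) ^ 4
           + 3125 * (dedekind_eta (5 * \<tau>) ^ 10 / dedekind_eta \<tau> ^ 2))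
         * ((\<theta> (x + y) * \<theta> (x - y) * \<theta> (2 * x) * \<theta> (2 * y)) / (\<theta> x *
             \<theta> y))"
\<comment> \<open>If 2y is a lattice point while y is not, then \<open>\<phi> p\<close> and
  \<open>\<phi> (2 * p)\<close> both vanish at y, so both sides are 0.\<close>
proof (cases "\<theta> (2 * y) = 0")
  case True
  then have "\<phi> p y = 0" "\<phi> (2 * p) y = 0"
    using assms by (auto intro!: \<phi>_half_period theta_function_\<phi>_p)
  then show ?thesis
    using True by (simp add: \<Phi>_def)
next
  case False
  let ?C = "250 * dedekind_eta \<tau> ^ 4 * dedekind_eta (5 * \<tau>) ^ 4
           + 3125 * (dedekind_eta (5 * \<tau>) ^ 10 / dedekind_eta \<tau> ^ 2)"
  have "(a * b) * (\<Phi> x y * \<theta> x * \<theta> y) = (a * b) * (?C * (\<theta> (x + y) * \<theta>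
      (x - y) * \<theta> (2 * x) * \<theta> (2 * y)))"
    using \<Phi>_eq[OF False, of x] unfolding eta_quotient_eq by (simp only: mult_ac)
  then have "\<Phi> x y * \<theta> x * \<theta> y = ?C * (\<theta> (x + y) * \<theta> (x - y) *
      \<theta> (2 * x) * \<theta> (2 * y))"
    by (subst (asm) mult_left_cancel) (simp_all add: a_neq_0 b_neq_0)
  then show ?thesis
    using assms by (simp add: eq_divide_eq mult.assoc)
qed

end

theorem theorem4p4:
  fixes \<tau> x y :: complex
  assumes "Im \<tau> > 0"
    and "theta1 x \<tau> * theta1 y \<tau> \<noteq> 0"
  shows "(theta1 (x + of_real pi / 5) \<tau> ^ 5 - theta1 (x - of_real pi / 5) \<tau> ^ 5)
           * (theta1 (y + 2 * of_real pi / 5) \<tau> ^ 5 - theta1 (y - 2 * of_real pi / 5) \<tau> ^ 5)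
         - (theta1 (y + of_real pi / 5) \<tau> ^ 5 - theta1 (y - of_real pi / 5) \<tau> ^ 5)
           * (theta1 (x + 2 * of_real pi / 5) \<tau> ^ 5 - theta1 (x - 2 * of_real pi / 5) \<tau> ^ 5)
       = (250 * dedekind_eta \<tau> ^ 4 * dedekind_eta (5 * \<tau>) ^ 4
           + 3125 * (dedekind_eta (5 * \<tau>) ^ 10 / dedekind_eta \<tau> ^ 2))
         * ((theta1 (x + y) \<tau> * theta1 (x - y) \<tau> * theta1 (2 * x) \<tau> * theta1 (2 * y)
             \<tau>)
             / (theta1 x \<tau> * theta1 y \<tau>))"
proof -
  interpret upper_half_plane \<tau>
    by standard (rule assms(1))
  show ?thesis
    using quintic_difference_identity[OF assms(2)]
    unfolding \<Phi>_def \<phi>_def p_def times_divide_eq_right .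
qed

end
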